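(* Let $\Gamma$ be a finitely generated group, let $f_i\colon\Gamma\to\mathbb{C}$ ($i\geqslant 1$) be functions, put $f=tf_1+t^2f_2+\cdots\colon\Gamma\to\mathbb{C}[[t]]$, and suppose that $u_\gamma\mapsto f(\gamma)$ (for $\gamma\in\Gamma$) defines a $\mathbb{C}$-algebra morphism from $A(\Gamma)^{\mathrm{SL}_2(\mathbb{C})}$ to $\mathbb{C}[[t]]$. Then there exists a representation $\rho\colon\Gamma\to\mathrm{SL}_2(\mathbb{C}[[t]])$ such that for all $\gamma\in\Gamma$, $$2+f(\gamma)=\mathrm{Tr}\,\rho(\gamma).$$ Moreover, the evaluation of $\rho$ at $t=0$ has trivial character (all traces equal to $2$), and hence is, up to conjugation in $\mathrm{SL}_2(\mathbb{C})$, a representation with values in the abelian group of unipotent upper triangular matrices.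
   Context: $R(\Gamma)=\mathrm{Hom}(\Gamma,\mathrm{SL}_2(\mathbb{C}))$, and $A(\Gamma)$ is its (possibly non-reduced) ring of regular functions: the $\mathbb{C}$-algebra generated by the entries $a^l_{i,j}$ of the matrices $\rho(\gamma_l)$, for $\gamma_1,\dots,\gamma_n$ generating $\Gamma$, modulo the relations coming from $\det\rho(\gamma_l)=1$ and from the relations of $\Gamma$. $\mathrm{SL}_2(\mathbb{C})$ acts by conjugation and $A(\Gamma)^{\mathrm{SL}_2(\mathbb{C})}$ is the subalgebra of invariants. For $\gamma\in\Gamma$, $t_\gamma(\rho)=\mathrm{Tr}\,\rho(\gamma)$ and $u_\gamma=t_\gamma-2$, elements of $A(\Gamma)^{\mathrm{SL}_2(\mathbb{C})}$. By a known theorem, $A(\Gamma)^{\mathrm{SL}_2(\mathbb{C})}$ is generated by the $t_\gamma$, and the ideal of relations among them is generated by $t_1=2$ and $t_\gamma t_\delta=t_{\gamma\delta}+t_{\gamma\delta^{-1}}$ ($\gamma,\delta\in\Gamma$); in terms of the $u_\gamma$: $u_1=0$ and $u_{\gamma\delta}+u_{\gamma\delta^{-1}}=2u_\gamma+2u_\delta+u_\gamma u_\delta$. *)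

theory Defs
  imports
    "HOL-Analysis.Analysis"
    "HOL-Algebra.Algebra"
    "HOL-Algebra.Algebraic_Closure_Type"
    "HOL-Library.Poly_Mapping"
begin

unbundle no fps_syntax
unbundle vec_syntax

definition SL2 :: "(('a::comm_ring_1)^2^2) monoid"
  where "SL2 = \<lparr>carrier = {A. det A = 1}, mult = (**), one = mat 1\<rparr>"

definition unipotent_upper :: "(('a::comm_ring_1)^2^2) monoid"
  where "unipotent_upper = SL2\<lparr>carrier := {A. A$1$1 = 1 \<and> A$2$2 = 1 \<and> A$2$1 = 0}\<rparr>"

definition adjugate2 :: "('a::comm_ring_1)^2^2 \<Rightarrow> 'a^2^2"
  where "adjugate2 A = vector [vector [A$2$2, - A$1$2], vector [- A$2$1, A$1$1]]"

lemma comm_group_unipotent_upper: "comm_group (unipotent_upper :: (('a::comm_ring_1)^2^2) monoid)"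
proof (rule comm_groupI)
  fix x :: "'a^2^2"
  assume x: "x \<in> carrier unipotent_upper"
  show "\<exists>y\<in>carrier unipotent_upper. y \<otimes>\<^bsub>unipotent_upper\<^esub> x = \<one>\<^bsub>unipotent_upper\<^esub>"
    using x by (intro bexI[of _ "adjugate2 x"])
      (auto simp: unipotent_upper_def SL2_def adjugate2_def matrix_matrix_mult_def mat_def
        vec_eq_iff forall_2 sum_2 vector_2)
qed (auto simp: unipotent_upper_def SL2_def matrix_matrix_mult_def mat_def vec_eq_iff
  forall_2 sum_2 vector_2 algebra_simps)

definition eval0 :: "complex fps^2^2 \<Rightarrow> complex^2^2"
  where "eval0 A = (\<chi> i j. fps_nth (A$i$j) 0)"

text \<open>
  A generating family of the group is a function \<open>s\<close> on a finite type \<open>'n\<close>. In a word, the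
  letter \<open>(l, True)\<close> stands for \<open>s l\<close> and \<open>(l, False)\<close> for its inverse.
\<close>

type_synonym 'n gword = "('n \<times> bool) list"

definition word_value :: "('g, 'm) monoid_scheme \<Rightarrow> ('n \<Rightarrow> 'g) \<Rightarrow> 'n gword \<Rightarrow> 'g"
  where "word_value G s w =
    foldr (\<lambda>(l, e) x. (if e then s l else inv\<^bsub>G\<^esub> (s l)) \<otimes>\<^bsub>G\<^esub> x) w \<one>\<^bsub>G\<^esub>"

text \<open>
  The polynomial ring over the complex numbers in the variables \<open>(l, i, j)\<close>, where \<open>(l, i, j)\<close>
  is the \<open>(i, j)\<close>-entry of the matrix of the generator \<open>s l\<close>; a monomial is a finitely supported
  exponent function.
\<close>

type_synonym 'n entry_poly = "(('n \<times> 2 \<times> 2) \<Rightarrow>\<^sub>0 nat) \<Rightarrow>\<^sub>0 complex"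

definition pconst :: "complex \<Rightarrow> 'n entry_poly"
  where "pconst c = Poly_Mapping.single 0 c"

definition pvar :: "'n \<times> 2 \<times> 2 \<Rightarrow> 'n entry_poly"
  where "pvar v = Poly_Mapping.single (Poly_Mapping.single v 1) 1"

definition psubst :: "('n \<times> 2 \<times> 2 \<Rightarrow> 'n entry_poly) \<Rightarrow> 'n entry_poly \<Rightarrow> 'n entry_poly"
  where "psubst \<sigma> p =
    (\<Sum>m\<in>Poly_Mapping.keys p. pconst (Poly_Mapping.lookup p m) *
       (\<Prod>v\<in>Poly_Mapping.keys m. \<sigma> v ^ Poly_Mapping.lookup m v))"

abbreviation entry_ring :: "'n entry_poly ring"
  where "entry_ring \<equiv> ring_of_type_algebra"

definition gen_matrix :: "'n \<Rightarrow> 'n entry_poly^2^2"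
  where "gen_matrix l = (\<chi> i j. pvar (l, i, j))"

text \<open>
  The inverse of a generator is represented by the adjugate, which is the inverse matrix once
  the determinants are 1.
\<close>

definition word_matrix :: "'n gword \<Rightarrow> 'n entry_poly^2^2"
  where "word_matrix w =
    foldr (\<lambda>(l, e) M. (if e then gen_matrix l else adjugate2 (gen_matrix l)) ** M) w (mat 1)"

definition rep_ideal :: "('g, 'm) monoid_scheme \<Rightarrow> ('n \<Rightarrow> 'g) \<Rightarrow> 'n entry_poly set"
  where "rep_ideal G s = Idl\<^bsub>entry_ring\<^esub>
    (range (\<lambda>l. det (gen_matrix l) - 1) \<union>
     {(word_matrix w - mat 1)$i$j | w i j. word_value G s w = \<one>\<^bsub>G\<^esub>})"

definition rep_ring :: "('g, 'm) monoid_scheme \<Rightarrow> ('n \<Rightarrow> 'g) \<Rightarrow> 'n entry_poly set ring"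
  where "rep_ring G s = entry_ring Quot rep_ideal G s"

definition rep_class :: "('g, 'm) monoid_scheme \<Rightarrow> ('n \<Rightarrow> 'g) \<Rightarrow> 'n entry_poly \<Rightarrow> 'n entry_poly set"
  where "rep_class G s p = rep_ideal G s +>\<^bsub>entry_ring\<^esub> p"

text \<open>
  The action of \<open>g\<close> sends the function \<open>F\<close> to \<open>\<rho> \<mapsto> F (g\<^sup>-\<^sup>1 \<rho> g)\<close>: on polynomials it substitutes
  the entries of \<open>g\<^sup>-\<^sup>1 X g\<close> for those of each generator matrix \<open>X\<close>. This substitution is an
  automorphism preserving the ideal of relations, so it permutes the cosets and acts on the
  quotient by taking images.
\<close>

definition conj_poly :: "complex^2^2 \<Rightarrow> 'n entry_poly \<Rightarrow> 'n entry_poly"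
  where "conj_poly g = psubst (\<lambda>(l, i, j).
    (map_matrix pconst (matrix_inv g) ** gen_matrix l ** map_matrix pconst g)$i$j)"

definition inv_ring :: "('g, 'm) monoid_scheme \<Rightarrow> ('n \<Rightarrow> 'g) \<Rightarrow> 'n entry_poly set ring"
  where "inv_ring G s = (rep_ring G s)
    \<lparr>carrier := {F \<in> carrier (rep_ring G s). \<forall>g \<in> carrier SL2. conj_poly g ` F = F}\<rparr>"

text \<open>
  The trace function of \<open>\<gamma>\<close>; its class does not depend on the word chosen to represent \<open>\<gamma>\<close>.
\<close>

definition trace_fun :: "('g, 'm) monoid_scheme \<Rightarrow> ('n \<Rightarrow> 'g) \<Rightarrow> 'g \<Rightarrow> 'n entry_poly set"
  where "trace_fun G s \<gamma> = rep_class G s (trace (word_matrix (SOME w. word_value G s w = \<gamma>)))"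

definition u_fun :: "('g, 'm) monoid_scheme \<Rightarrow> ('n \<Rightarrow> 'g) \<Rightarrow> 'g \<Rightarrow> 'n entry_poly set"
  where "u_fun G s \<gamma> = trace_fun G s \<gamma> \<ominus>\<^bsub>rep_ring G s\<^esub> rep_class G s (pconst 2)"

definition inv_alg_hom ::
    "('g, 'm) monoid_scheme \<Rightarrow> ('n \<Rightarrow> 'g) \<Rightarrow> ('n entry_poly set \<Rightarrow> complex fps) set"
  where "inv_alg_hom G s = {\<phi> \<in> ring_hom (inv_ring G s) ring_of_type_algebra.
    \<forall>c. \<phi> (rep_class G s (pconst c)) = fps_const c}"

end

theory Submission
  imports Defs
begin

text \<open>
  Put \<open>x \<gamma> = 2 + f \<gamma>\<close> and \<open>O = \<complex>[[t]]\<close>. If \<open>\<rho>\<close> has character \<open>x\<close>, then the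
  matrices \<open>a' = 2 \<rho>(a) - x a\<close> span a lattice of traceless matrices, and the traces of products of
  two or three of them are determined by \<open>x\<close>: they are given by the symmetric form
  \<open>B(a, b) = tr(a' b') / 2 = 2 x(ab) - x a x b\<close> and by the alternating form \<open>T(a, b, c) = tr(a' b' c') / 4
  = 2 x(abc) - x a x(bc) - x b x(ac) - x c x(ab) + x a x b x c\<close>. The idea is to read
  the lattice off \<open>B\<close> and \<open>T\<close>, choosing matrices with entries in \<open>O\<close> (and not just in its
  fraction field) for a basis of it.

  Two identities make this possible: \<open>-4 T(a, b, c) T(e, f, g)\<close> is the Gram determinant of \<open>B\<close>
  (\<open>matrix_volume_gram\<close>), and \<open>B\<close> and \<open>T\<close> satisfy the linear relation of four vectors in a
  three-dimensional space (\<open>matrix_volume_cramer\<close>). Both hold for traces of \<open>2 \<times> 2\<close> matrices over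
  any commutative ring, hence for the tautological matrices over \<open>A(\<Gamma>)\<close>; all traces in them are
  invariant, so the morphism to \<open>O\<close> carries them to \<open>x\<close> (\<open>invariant_hom_character\<close>).

  It follows that \<open>B\<close> has rank at most 3. As \<open>O\<close> is a discrete valuation ring in which 2 is
  invertible and units have square roots, \<open>B\<close> can be diagonalised by pivots of minimal valuation:
  \<open>B(a, b) = \<Sum>i. t^n_i \<alpha>_i(a) \<alpha>_i(b)\<close> with coordinates in \<open>O\<close> (\<open>fps_diagonalise3\<close>).

  If \<open>T\<close> is not zero, the Gram identity shows that \<open>-t^(n_1 + n_2 + n_3)\<close> is a square, so that
  \<open>n_1 + n_2 + n_3 = 2 M\<close> and \<open>2 T = \<epsilon> t^M det(\<alpha>)\<close> with \<open>\<epsilon>^2 = -1\<close>. One of the exponents is then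
  even, and for this reason there are traceless anticommuting matrices over \<open>O\<close> with squares
  \<open>t^n_i\<close> and the correct orientation, variants of the Pauli matrices (\<open>pauli\<close>). The representation
  is \<open>\<rho>(a) = (x a + \<Sum>i. \<alpha>_i(a) M_i) / 2\<close>. If \<open>T\<close> is zero, then associativity forces \<open>B\<close> to have
  rank at most one, \<open>B(a, b) = t^n \<alpha>(a) \<alpha>(b)\<close>, and a single matrix with square \<open>t^n\<close> suffices.
  No lattice has to be adjusted afterwards, because coordinates and basis are integral.

  At \<open>t = 0\<close> all traces are 2. If some matrix of such a representation is not the identity, a
  conjugation makes it upper triangular, and comparing the traces of its products with the other
  matrices makes all of them unipotent upper triangular (\<open>trivial_character_unipotent\<close>).
\<close>

unbundle no Formal_Power_Series.fps_syntax

section \<open>Symmetric forms of small rank over complex power series\<close>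

text \<open>
  The index set carries no module structure, so the rank of a form is bounded by the vanishing of the
  minors of its value table. The first half of the indices of a minor selects the rows, the second
  half the columns.
\<close>

definition minor2 :: "('a \<Rightarrow> 'a \<Rightarrow> 'r::comm_ring_1) \<Rightarrow> 'a \<Rightarrow> 'a \<Rightarrow> 'a \<Rightarrow> 'a \<Rightarrow> 'r"
  where "minor2 B a b e f = B a e * B b f - B a f * B b e"

definition minor3 :: "('a \<Rightarrow> 'a \<Rightarrow> 'r::comm_ring_1) \<Rightarrow> 'a \<Rightarrow> 'a \<Rightarrow> 'a \<Rightarrow> 'a \<Rightarrow> 'a \<Rightarrow> 'a \<Rightarrow> 'r"
  where "minor3 B a b c e f g =
    B a e * minor2 B b c f g - B a f * minor2 B b c e g + B a g * minor2 B b c e f"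

definition minor4 ::
    "('a \<Rightarrow> 'a \<Rightarrow> 'r::comm_ring_1) \<Rightarrow> 'a \<Rightarrow> 'a \<Rightarrow> 'a \<Rightarrow> 'a \<Rightarrow> 'a \<Rightarrow> 'a \<Rightarrow> 'a \<Rightarrow> 'a \<Rightarrow> 'r"
  where "minor4 B a b c d e f g h =
    B a e * minor3 B b c d f g h - B a f * minor3 B b c d e g h
    + B a g * minor3 B b c d e f h - B a h * minor3 B b c d e f g"

definition minors2_vanish :: "'a set \<Rightarrow> ('a \<Rightarrow> 'a \<Rightarrow> 'r::comm_ring_1) \<Rightarrow> bool"
  where "minors2_vanish S B \<longleftrightarrow>
    (\<forall>a\<in>S. \<forall>b\<in>S. \<forall>e\<in>S. \<forall>f\<in>S. minor2 B a b e f = 0)"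

definition minors3_vanish :: "'a set \<Rightarrow> ('a \<Rightarrow> 'a \<Rightarrow> 'r::comm_ring_1) \<Rightarrow> bool"
  where "minors3_vanish S B \<longleftrightarrow>
    (\<forall>a\<in>S. \<forall>b\<in>S. \<forall>c\<in>S. \<forall>e\<in>S. \<forall>f\<in>S. \<forall>g\<in>S. minor3 B a b c e f g = 0)"

definition minors4_vanish :: "'a set \<Rightarrow> ('a \<Rightarrow> 'a \<Rightarrow> 'r::comm_ring_1) \<Rightarrow> bool"
  where "minors4_vanish S B \<longleftrightarrow>
    (\<forall>a\<in>S. \<forall>b\<in>S. \<forall>c\<in>S. \<forall>d\<in>S. \<forall>e\<in>S. \<forall>f\<in>S. \<forall>g\<in>S. \<forall>h\<in>S. minor4 B a b c d e f g h = 0)"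

lemma fps_sqrt_unit:
  fixes u :: "complex fps"
  assumes "fps_nth u 0 \<noteq> 0"
  obtains v where "v * v = u" "v \<noteq> 0" "v dvd 1"
proof -
  define v where "v = fps_radical (\<lambda>k. csqrt) (Suc 1) u"
  have "v ^ Suc 1 = u"
    unfolding v_def using power_radical[OF assms, of "\<lambda>k. csqrt" 1] power2_csqrt[of "fps_nth u 0"]
    by (simp del: power2_csqrt add: numeral_2_eq_2)
  hence "v * v = u" by (simp add: power2_eq_square)
  moreover from this have "fps_nth v 0 \<noteq> 0" using assms by auto
  ultimately show ?thesis using that[of v] by (metis fps_is_unit_iff fps_zero_nth)
qed

text \<open>
  A vector of minimal valuation splits off over a valuation ring. The least valuation \<open>n\<close> of all
  values of \<open>B\<close> may be attained only off the diagonal, at \<open>(a, b)\<close>; then it is attained by the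
  formal sum of \<open>a\<close> and \<open>b\<close>, because 2 is a unit. The pivot vector is therefore the formal combination
  \<open>p + c q\<close>, and its value is \<open>t^n u^2\<close> with a unit \<open>u\<close>, which is where square roots of units
  enter. The function \<open>\<alpha>\<close> is the coordinate along the pivot, with the unit absorbed.
\<close>

lemma fps_pivot:
  fixes B :: "'a \<Rightarrow> 'a \<Rightarrow> complex fps"
  assumes sym: "\<forall>a\<in>S. \<forall>b\<in>S. B a b = B b a"
    and nz: "\<exists>a\<in>S. \<exists>b\<in>S. B a b \<noteq> 0"
  obtains n \<alpha> u c p q where "p \<in> S" "q \<in> S" "u \<noteq> 0"
    "\<And>a. a \<in> S \<Longrightarrow> B p a + c * B q a = fps_X ^ n * u * \<alpha> a" "\<alpha> p + c * \<alpha> q = u"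
proof -
  define P where "P n \<longleftrightarrow> (\<exists>a\<in>S. \<exists>b\<in>S. B a b \<noteq> 0 \<and> subdegree (B a b) = n)" for n
  define n where "n = (LEAST n. P n)"
  have "\<exists>n. P n" using nz by (auto simp: P_def)
  hence "P n" unfolding n_def by (rule LeastI_ex)
  then obtain a b where ab: "a \<in> S" "b \<in> S" "B a b \<noteq> 0" "subdegree (B a b) = n"
    by (auto simp: P_def)
  have low: "fps_nth (B d e) k = 0" if "d \<in> S" "e \<in> S" "k < n" for d e k
  proof (rule ccontr)
    assume *: "fps_nth (B d e) k \<noteq> 0"
    hence "B d e \<noteq> 0" by auto
    hence "P (subdegree (B d e))" using that by (auto simp: P_def)
    hence "n \<le> subdegree (B d e)" unfolding n_def by (rule Least_le)
    thus False using * that nth_less_subdegree_zero[of k "B d e"] by simp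
  qed
  have abn: "fps_nth (B a b) n \<noteq> 0" using ab by force
  \<comment> \<open>For c = 1 the vector is the sum of two elements; c = 0 leaves a single element.\<close>
  obtain p q c where pq: "p \<in> S" "q \<in> S"
    and npq: "fps_nth (B p p + c * B p q + c * (B q p + c * B q q)) n \<noteq> 0"
  proof (cases "fps_nth (B a a) n = 0 \<and> fps_nth (B b b) n = 0")
    case True
    have "B b a = B a b" using sym ab by blast
    with True abn have "fps_nth (B a a + 1 * B a b + 1 * (B b a + 1 * B b b)) n \<noteq> 0"
      by simp
    with ab show ?thesis using that by blast
  next
    case False
    then obtain r where "r \<in> S" "fps_nth (B r r) n \<noteq> 0" using ab by auto
    thus ?thesis using that[of r r 0] by simp
  qed
  define d where "d = B p p + c * B p q + c * (B q p + c * B q q)"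
  have dvd: "fps_X ^ n dvd B d e" if "d \<in> S" "e \<in> S" for d e
  proof (cases "B d e = 0")
    case False
    hence "n \<le> subdegree (B d e)" using low[OF that] by (metis nth_subdegree_nonzero not_le)
    hence "B d e = fps_shift n (B d e) * fps_X ^ n" by (rule subdegree_decompose')
    thus ?thesis by (metis dvd_triv_right)
  qed simp
  have "fps_X ^ n dvd d" unfolding d_def using dvd pq by (intro dvd_add dvd_mult) auto
  then obtain u0 where u0: "d = fps_X ^ n * u0" by (elim dvdE)
  have "fps_nth u0 0 \<noteq> 0" using npq unfolding d_def[symmetric] u0
    by (simp add: fps_X_power_mult_nth)
  then obtain u where u: "u * u = u0" "u \<noteq> 0" "u dvd 1" by (rule fps_sqrt_unit)
  have "\<exists>y. B p a + c * B q a = fps_X ^ n * u * y" if "a \<in> S" for a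
  proof -
    have "fps_X ^ n * u dvd fps_X ^ n" using u(3) by (metis dvd_refl mult.right_neutral mult_dvd_mono)
    moreover have "fps_X ^ n dvd B p a + c * B q a"
      using dvd pq that by (intro dvd_add dvd_mult) auto
    ultimately show ?thesis by (meson dvdE dvd_trans)
  qed
  then obtain \<alpha> where \<alpha>: "\<And>a. a \<in> S \<Longrightarrow> B p a + c * B q a = fps_X ^ n * u * \<alpha> a" by metis
  have "fps_X ^ n * u * (\<alpha> p + c * \<alpha> q) = d"
    using \<alpha>[OF pq(1)] \<alpha>[OF pq(2)] bspec[OF bspec[OF sym pq(1)] pq(2)] unfolding d_def by (simp add: algebra_simps)
  also have "\<dots> = fps_X ^ n * u * u" by (simp add: u0 u(1)[symmetric] mult.assoc)
  finally have "\<alpha> p + c * \<alpha> q = u" using u(2) by simp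
  with pq u(2) \<alpha> that show ?thesis by blast
qed

text \<open>
  Removing the pivot lowers the rank by one. Since the remaining form vanishes on the pivot vector, a
  minor of it is, up to a nonzero factor, the minor of \<open>B\<close> with the pivot vector as an additional row
  and column; as the pivot is a combination of two elements, that larger minor is a combination of
  minors of \<open>B\<close>.
\<close>

lemma fps_pivot_rank:
  fixes B :: "'a \<Rightarrow> 'a \<Rightarrow> complex fps"
  assumes sym: "\<forall>a\<in>S. \<forall>b\<in>S. B a b = B b a"
  obtains n \<alpha> where
    "minors2_vanish S B \<Longrightarrow> \<forall>a\<in>S. \<forall>e\<in>S. B a e = fps_X ^ n * \<alpha> a * \<alpha> e"
    "minors3_vanish S B \<Longrightarrow> minors2_vanish S (\<lambda>a e. B a e - fps_X ^ n * \<alpha> a * \<alpha> e)"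
    "minors4_vanish S B \<Longrightarrow> minors3_vanish S (\<lambda>a e. B a e - fps_X ^ n * \<alpha> a * \<alpha> e)"
proof (cases "\<exists>a\<in>S. \<exists>b\<in>S. B a b \<noteq> 0")
  case False
  hence z: "B a b = 0" if "a \<in> S" "b \<in> S" for a b using that by blast
  show ?thesis
  proof (rule that[of 0 "\<lambda>_. 0"])
    show "\<forall>a\<in>S. \<forall>e\<in>S. B a e = fps_X ^ 0 * 0 * 0" by (simp add: z)
    show "minors2_vanish S (\<lambda>a e. B a e - fps_X ^ 0 * 0 * 0)"
      by (simp add: minors2_vanish_def minor2_def z)
    show "minors3_vanish S (\<lambda>a e. B a e - fps_X ^ 0 * 0 * 0)"
      by (simp add: minors3_vanish_def minor3_def z)
  qed
next
  case True
  obtain n \<alpha> u k p q where pq: "p \<in> S" "q \<in> S" and u: "u \<noteq> 0"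
    and row: "\<And>a. a \<in> S \<Longrightarrow> B p a + k * B q a = fps_X ^ n * u * \<alpha> a"
    and piv: "\<alpha> p + k * \<alpha> q = u"
    using fps_pivot[of S B, OF sym True] by metis
  define t where "t = (fps_X ^ n :: complex fps)"
  have t: "t \<noteq> 0" by (simp add: t_def)
  note row = row[folded t_def]
  have rowp: "B p a = t * u * \<alpha> a - k * B q a" if "a \<in> S" for a
    using row[OF that] by (simp add: algebra_simps)
  have colp: "B a p = t * u * \<alpha> a - k * B a q" if "a \<in> S" for a
    using rowp[OF that] sym that pq by simp
  have \<alpha>p: "\<alpha> p = u - k * \<alpha> q" using piv by (simp add: algebra_simps)
  define C where "C = (\<lambda>a e. B a e - t * \<alpha> a * \<alpha> e)"
  have C1: "C a e = 0" if m: "minors2_vanish S B"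
    and S: "a \<in> S" "e \<in> S" for a e
  proof -
    \<comment> \<open>Up to the factor \<open>t * u\<close>, this is the minor with the pivot as first row and \<open>s\<close> as first column.\<close>
    define N where "N s = \<alpha> s * B a e - \<alpha> e * B a s" for s
    have "t * u * N s = 0" if "s \<in> S" for s
    proof -
      have "t * u * N s = minor2 B p a s e + k * minor2 B q a s e"
        unfolding minor2_def N_def rowp[OF S(2)] rowp[OF that] by (simp add: algebra_simps)
      thus ?thesis using m that pq S unfolding minors2_vanish_def by simp
    qed
    hence "N p + k * N q = 0" using pq u t by simp
    moreover have "N p + k * N q = u * C a e"
      unfolding N_def C_def colp[OF S(1)] \<alpha>p by (simp add: algebra_simps)
    ultimately show ?thesis using u by simp
  qed
  have C2: "minor2 C a b e f = 0"
    if m: "minors3_vanish S B"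
    and S: "a \<in> S" "b \<in> S" "e \<in> S" "f \<in> S" for a b e f
  proof -
    define N where "N s = \<alpha> s * minor2 B a b e f - \<alpha> e * minor2 B a b s f + \<alpha> f * minor2 B a b s e" for s
    have "t * u * N s = 0" if "s \<in> S" for s
    proof -
      have "t * u * N s = minor3 B p a b s e f + k * minor3 B q a b s e f"
        unfolding minor3_def N_def rowp[OF S(3)] rowp[OF S(4)] rowp[OF that] by (simp add: algebra_simps)
      thus ?thesis using m that pq S unfolding minors3_vanish_def by simp
    qed
    hence "N p + k * N q = 0" using pq u t by simp
    moreover have "N p + k * N q = u * minor2 C a b e f"
      unfolding N_def minor2_def C_def colp[OF S(1)] colp[OF S(2)] \<alpha>p by (simp add: algebra_simps)
    ultimately show ?thesis using u by simp
  qed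
  have C3: "minor3 C a b c e f g = 0"
    if m: "minors4_vanish S B"
    and S: "a \<in> S" "b \<in> S" "c \<in> S" "e \<in> S" "f \<in> S" "g \<in> S" for a b c e f g
  proof -
    define N where "N s = \<alpha> s * minor3 B a b c e f g - \<alpha> e * minor3 B a b c s f g
      + \<alpha> f * minor3 B a b c s e g - \<alpha> g * minor3 B a b c s e f" for s
    have "t * u * N s = 0" if "s \<in> S" for s
    proof -
      have "t * u * N s = minor4 B p a b c s e f g + k * minor4 B q a b c s e f g"
        unfolding minor4_def N_def rowp[OF S(4)] rowp[OF S(5)] rowp[OF S(6)] rowp[OF that]
        by (simp add: algebra_simps)
      thus ?thesis using m that pq S unfolding minors4_vanish_def by simp
    qed
    hence "N p + k * N q = 0" using pq u t by simp
    moreover have "N p + k * N q = u * minor3 C a b c e f g"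
    proof -
      define L where "L f g = \<alpha> a * minor2 B b c f g - \<alpha> b * minor2 B a c f g + \<alpha> c * minor2 B a b f g"
        for f g
      have L: "minor3 B a b c p f g = t * u * L f g - k * minor3 B a b c q f g" for f g
        unfolding L_def minor3_def minor2_def colp[OF S(1)] colp[OF S(2)] colp[OF S(3)]
        by (simp add: algebra_simps)
      have "N p + k * N q
          = u * (minor3 B a b c e f g - t * (\<alpha> e * L f g - \<alpha> f * L e g + \<alpha> g * L e f))"
        unfolding N_def L \<alpha>p by (simp add: algebra_simps)
      also have "minor3 B a b c e f g - t * (\<alpha> e * L f g - \<alpha> f * L e g + \<alpha> g * L e f)
          = minor3 C a b c e f g"
        unfolding L_def minor3_def minor2_def C_def by (simp add: algebra_simps)
      finally show ?thesis .
    qed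
    ultimately show ?thesis using u by simp
  qed
  show ?thesis
  proof (rule that[of n \<alpha>, folded t_def, folded C_def])
    show "\<forall>a\<in>S. \<forall>e\<in>S. B a e = t * \<alpha> a * \<alpha> e" if "minors2_vanish S B"
      using C1[OF that] by (simp add: C_def)
    show "minors2_vanish S C" if "minors3_vanish S B"
      using C2[OF that] unfolding minors2_vanish_def by blast
    show "minors3_vanish S C" if "minors4_vanish S B"
      using C3[OF that] unfolding minors3_vanish_def by blast
  qed
qed

text \<open>
  Missing pivots are represented by coordinate functions equal to zero, so that each diagonal entry is
  an honest power of \<open>t\<close> whatever the rank is.
\<close>

lemma fps_diagonalise3:
  fixes B :: "'a \<Rightarrow> 'a \<Rightarrow> complex fps"
  assumes sym: "\<forall>a\<in>S. \<forall>b\<in>S. B a b = B b a" and rank: "minors4_vanish S B"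
  obtains n1 n2 n3 \<alpha>1 \<alpha>2 \<alpha>3 where
    "\<And>a b. a \<in> S \<Longrightarrow> b \<in> S \<Longrightarrow> B a b = fps_X ^ n1 * \<alpha>1 a * \<alpha>1 b
       + fps_X ^ n2 * \<alpha>2 a * \<alpha>2 b + fps_X ^ n3 * \<alpha>3 a * \<alpha>3 b"
proof -
  obtain n1 \<alpha>1 where r3: "minors3_vanish S (\<lambda>a e. B a e - fps_X ^ n1 * \<alpha>1 a * \<alpha>1 e)"
    using fps_pivot_rank[OF sym] rank by metis
  define C where "C = (\<lambda>a e. B a e - fps_X ^ n1 * \<alpha>1 a * \<alpha>1 e)"
  have Csym: "\<forall>a\<in>S. \<forall>b\<in>S. C a b = C b a" using sym by (simp add: C_def mult_ac)
  obtain n2 \<alpha>2 where r2: "minors2_vanish S (\<lambda>a e. C a e - fps_X ^ n2 * \<alpha>2 a * \<alpha>2 e)"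
    using fps_pivot_rank[OF Csym] r3[folded C_def] by metis
  define D where "D = (\<lambda>a e. C a e - fps_X ^ n2 * \<alpha>2 a * \<alpha>2 e)"
  have Dsym: "\<forall>a\<in>S. \<forall>b\<in>S. D a b = D b a" using Csym by (simp add: D_def mult_ac)
  obtain n3 \<alpha>3 where D: "\<forall>a\<in>S. \<forall>e\<in>S. D a e = fps_X ^ n3 * \<alpha>3 a * \<alpha>3 e"
    using fps_pivot_rank[OF Dsym] r2[folded D_def] by metis
  have "B a b = fps_X ^ n1 * \<alpha>1 a * \<alpha>1 b + fps_X ^ n2 * \<alpha>2 a * \<alpha>2 b + fps_X ^ n3 * \<alpha>3 a * \<alpha>3 b"
    if "a \<in> S" "b \<in> S" for a b
  proof -
    have "B a b - fps_X ^ n1 * \<alpha>1 a * \<alpha>1 b - fps_X ^ n2 * \<alpha>2 a * \<alpha>2 b = fps_X ^ n3 * \<alpha>3 a * \<alpha>3 b"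
      using D that by (simp add: C_def D_def)
    thus ?thesis by (simp add: algebra_simps)
  qed
  thus ?thesis by (rule that)
qed

lemma fps_diagonalise1:
  fixes B :: "'a \<Rightarrow> 'a \<Rightarrow> complex fps"
  assumes "\<forall>a\<in>S. \<forall>b\<in>S. B a b = B b a" and "minors2_vanish S B"
  obtains n \<alpha> where "\<And>a b. a \<in> S \<Longrightarrow> b \<in> S \<Longrightarrow> B a b = fps_X ^ n * \<alpha> a * \<alpha> b"
  using fps_pivot_rank[OF assms(1)] assms(2) by metis

section \<open>Trace identities of 2 by 2 matrices\<close>

text \<open>
  If \<open>x\<close> is the character of \<open>\<rho>\<close>, these are the traces of \<open>a' b'\<close> and \<open>a' b' c'\<close>, divided by 2
  and 4, for the traceless matrices \<open>a' = 2 \<rho>(a) - x a\<close>. The scaling avoids denominators. The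
  second function is alternating, the oriented volume of three vectors.
\<close>

definition trace_form :: "('g, 'm) monoid_scheme \<Rightarrow> ('g \<Rightarrow> 'r::comm_ring_1) \<Rightarrow> 'g \<Rightarrow> 'g \<Rightarrow> 'r"
  where "trace_form G x a b = 2 * x (a \<otimes>\<^bsub>G\<^esub> b) - x a * x b"

definition trace_volume :: "('g, 'm) monoid_scheme \<Rightarrow> ('g \<Rightarrow> 'r::comm_ring_1) \<Rightarrow> 'g \<Rightarrow> 'g \<Rightarrow> 'g \<Rightarrow> 'r"
  where "trace_volume G x a b c = 2 * x (a \<otimes>\<^bsub>G\<^esub> b \<otimes>\<^bsub>G\<^esub> c)
    - x a * x (b \<otimes>\<^bsub>G\<^esub> c) - x b * x (a \<otimes>\<^bsub>G\<^esub> c) - x c * x (a \<otimes>\<^bsub>G\<^esub> b) + x a * x b * x c"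

text \<open>
  The same two expressions for matrices, to be used for the tautological matrices over the ring of
  polynomials in their entries.
\<close>

definition matrix_form :: "'r::comm_ring_1^2^2 \<Rightarrow> 'r^2^2 \<Rightarrow> 'r"
  where "matrix_form A B = 2 * trace (A ** B) - trace A * trace B"

definition matrix_volume :: "'r::comm_ring_1^2^2 \<Rightarrow> 'r^2^2 \<Rightarrow> 'r^2^2 \<Rightarrow> 'r"
  where "matrix_volume A B C = 2 * trace (A ** B ** C)
    - trace A * trace (B ** C) - trace B * trace (A ** C) - trace C * trace (A ** B)
    + trace A * trace B * trace C"

text \<open>
  Both expressions see only the vector with coordinates \<open>A11 - A22\<close>, \<open>A12\<close>, \<open>A21\<close>: in these
  coordinates, the form has a matrix of determinant -4, and the volume is the determinant of the three
  coordinate vectors.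
\<close>

lemma matrix_form_coords: "matrix_form A B =
    (A$1$1 - A$2$2) * (B$1$1 - B$2$2) + 2 * (A$1$2 * B$2$1) + 2 * (A$2$1 * B$1$2)"
  by (simp add: matrix_form_def trace_def matrix_matrix_mult_def sum_2 algebra_simps)

lemma matrix_volume_coords: "matrix_volume A B C =
    (A$1$1 - A$2$2) * (B$1$2 * C$2$1 - B$2$1 * C$1$2)
    - A$1$2 * ((B$1$1 - B$2$2) * C$2$1 - B$2$1 * (C$1$1 - C$2$2))
    + A$2$1 * ((B$1$1 - B$2$2) * C$1$2 - B$1$2 * (C$1$1 - C$2$2))"
  by (simp add: matrix_volume_def trace_def matrix_matrix_mult_def sum_2 algebra_simps)

text \<open>
  A Gram determinant is the product of two volumes and the determinant -4 of the form.
\<close>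

lemma matrix_volume_gram:
  "4 * matrix_volume A B C * matrix_volume D E F = - minor3 matrix_form A B C D E F"
proof -
  define a b c d e f where "a = A$1$1 - A$2$2" and "b = B$1$1 - B$2$2" and "c = C$1$1 - C$2$2"
    and "d = D$1$1 - D$2$2" and "e = E$1$1 - E$2$2" and "f = F$1$1 - F$2$2"
  note abc = a_def[symmetric] b_def[symmetric] c_def[symmetric] d_def[symmetric] e_def[symmetric] f_def[symmetric]
  show ?thesis
    unfolding minor3_def minor2_def matrix_form_coords matrix_volume_coords abc
    by (simp add: algebra_simps)
qed

text \<open>
  Four vectors in a three-dimensional space satisfy Cramer's linear relation, here paired with a fifth
  vector.
\<close>

lemma matrix_volume_cramer:
  "matrix_form A E * matrix_volume F G H - matrix_form A F * matrix_volume E G H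
    + matrix_form A G * matrix_volume E F H - matrix_form A H * matrix_volume E F G = 0"
proof -
  define a e f g h where "a = A$1$1 - A$2$2" and "e = E$1$1 - E$2$2" and "f = F$1$1 - F$2$2"
    and "g = G$1$1 - G$2$2" and "h = H$1$1 - H$2$2"
  note abc = a_def[symmetric] e_def[symmetric] f_def[symmetric] g_def[symmetric] h_def[symmetric]
  show ?thesis
    unfolding matrix_form_coords matrix_volume_coords abc by (simp add: algebra_simps)
qed

lemma trace_square: "trace (A ** A) = trace A * trace A - 2 * det (A :: 'r::comm_ring_1^2^2)"
  by (simp add: trace_def matrix_matrix_mult_def sum_2 det_2 algebra_simps)

section \<open>Representations from traceless parts\<close>

lemmas mat2_simps = vec_eq_iff forall_2 sum_2 matrix_matrix_mult_def mat_def trace_def det_2 vector_2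

lemma fps_half: "fps_const (1/2) * (2 * y) = (y :: complex fps)"
proof -
  have "fps_const (1/2) * (2 :: complex fps) = 1"
    by (metis fps_const_1_eq_1 fps_const_mult fps_numeral_fps_const nonzero_eq_divide_eq zero_neq_numeral)
  thus ?thesis by (metis mult.assoc mult_1)
qed

text \<open>
  The properties of an \<open>SL\<^sub>2\<close>-character that the construction of a representation uses.
\<close>

locale sl2_character = group G for G :: "('g, 'm) monoid_scheme" (structure) +
  fixes x :: "'g \<Rightarrow> complex fps"
  assumes x_comm: "\<lbrakk>a \<in> carrier G; b \<in> carrier G\<rbrakk> \<Longrightarrow> x (a \<otimes> b) = x (b \<otimes> a)"
    and x_square: "a \<in> carrier G \<Longrightarrow> x (a \<otimes> a) = x a * x a - 2"
    and volume_gram: "\<lbrakk>a \<in> carrier G; b \<in> carrier G; c \<in> carrier G;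
        e \<in> carrier G; f \<in> carrier G; g \<in> carrier G\<rbrakk> \<Longrightarrow>
      4 * trace_volume G x a b c * trace_volume G x e f g = - minor3 (trace_form G x) a b c e f g"
    and volume_cramer: "\<lbrakk>a \<in> carrier G; e \<in> carrier G; f \<in> carrier G;
        g \<in> carrier G; h \<in> carrier G\<rbrakk> \<Longrightarrow>
      trace_form G x a e * trace_volume G x f g h - trace_form G x a f * trace_volume G x e g h
      + trace_form G x a g * trace_volume G x e f h - trace_form G x a h * trace_volume G x e f g = 0"
begin

abbreviation "S \<equiv> carrier G"
abbreviation "form \<equiv> trace_form G x"
abbreviation "vol \<equiv> trace_volume G x"

lemma form_sym: "\<forall>a\<in>S. \<forall>b\<in>S. form a b = form b a"
  by (simp add: trace_form_def x_comm mult.commute)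

text \<open>
  This rule for products shows how multiplication in the group acts on the traceless parts: the last
  summand is the contribution of the vector product.
\<close>

lemma form_mult:
  "\<lbrakk>a \<in> S; b \<in> S; c \<in> S\<rbrakk> \<Longrightarrow> 2 * form (a \<otimes> b) c = x a * form b c + x b * form a c + 2 * vol a b c"
  by (simp add: trace_form_def trace_volume_def m_assoc algebra_simps)

text \<open>
  The representation is \<open>\<rho>(a) = (x a + \<beta> a) / 2\<close>; the hypothesis is the product formula for the
  traceless parts \<open>\<beta> a = 2 \<rho>(a) - x a\<close> of a representation. The determinant is 1 because
  \<open>2 det \<rho>(a) = (tr \<rho>(a))^2 - tr \<rho>(a^2)\<close>.
\<close>

lemma representation_from_pure_part:
  fixes \<beta> :: "'g \<Rightarrow> complex fps^2^2"
  assumes trace0: "\<And>a. a \<in> S \<Longrightarrow> trace (\<beta> a) = 0"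
    and mult: "\<And>a b. \<lbrakk>a \<in> S; b \<in> S\<rbrakk> \<Longrightarrow>
      \<beta> a ** \<beta> b = (\<chi> i j. (mat (form a b))$i$j + 2 * \<beta> (a \<otimes> b)$i$j - x a * \<beta> b$i$j - x b * \<beta> a$i$j)"
  shows "\<exists>\<rho> \<in> hom G SL2. \<forall>a \<in> S. trace (\<rho> a) = x a"
proof -
  define h where "h = (fps_const (1/2) :: complex fps)"
  have h: "h * (2 * y) = y" for y by (simp add: h_def fps_half)
  have h2: "2 * h = 1" using h[of 1] by (simp add: mult.commute)
  define \<rho> where "\<rho> a = (\<chi> i j. h * ((mat (x a))$i$j + \<beta> a$i$j))" for a
  have tr: "trace (\<rho> a) = x a" if "a \<in> S" for a
  proof -
    have "\<beta> a$2$2 = - \<beta> a$1$1"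
      using trace0[OF that] by (simp add: trace_def sum_2 add_eq_0_iff)
    moreover have "h * (x a + y) + h * (x a - y) = x a" for y
    proof -
      have "h * (x a + y) + h * (x a - y) = h * (2 * x a)" by (simp add: algebra_simps)
      thus ?thesis by (simp only: h)
    qed
    ultimately show ?thesis by (simp add: \<rho>_def trace_def sum_2 mat_def)
  qed
  have hom: "\<rho> a ** \<rho> b = \<rho> (a \<otimes> b)" if S: "a \<in> S" "b \<in> S" for a b
  proof -
    have m: "\<beta> a$i$1 * \<beta> b$1$j + \<beta> a$i$2 * \<beta> b$2$j =
        (mat (form a b))$i$j + 2 * \<beta> (a \<otimes> b)$i$j - x a * \<beta> b$i$j - x b * \<beta> a$i$j" for i j
    proof -
      have "(\<beta> a ** \<beta> b)$i$j = (mat (form a b))$i$j + 2 * \<beta> (a \<otimes> b)$i$j - x a * \<beta> b$i$j - x b * \<beta> a$i$j"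
        unfolding mult[OF S] by simp
      thus ?thesis by (simp only: matrix_matrix_mult_def sum_2 vec_lambda_beta)
    qed
    have "\<rho> a$i$1 * \<rho> b$1$j + \<rho> a$i$2 * \<rho> b$2$j = \<rho> (a \<otimes> b)$i$j" for i j
    proof -
      have "((mat (x a))$i$1 + \<beta> a$i$1) * ((mat (x b))$1$j + \<beta> b$1$j)
            + ((mat (x a))$i$2 + \<beta> a$i$2) * ((mat (x b))$2$j + \<beta> b$2$j)
          = (mat (x a))$i$1 * (mat (x b))$1$j + (mat (x a))$i$2 * (mat (x b))$2$j
            + ((mat (x a))$i$1 * \<beta> b$1$j + (mat (x a))$i$2 * \<beta> b$2$j)
            + ((mat (x b))$1$j * \<beta> a$i$1 + (mat (x b))$2$j * \<beta> a$i$2)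
            + (\<beta> a$i$1 * \<beta> b$1$j + \<beta> a$i$2 * \<beta> b$2$j)"
        by (simp add: algebra_simps)
      also have "\<dots> = 2 * ((mat (x (a \<otimes> b)))$i$j + \<beta> (a \<otimes> b)$i$j)"
        unfolding m using exhaust_2[of i] exhaust_2[of j]
        by (auto simp: mat_def trace_form_def algebra_simps)
      finally have "h * h * (((mat (x a))$i$1 + \<beta> a$i$1) * ((mat (x b))$1$j + \<beta> b$1$j)
            + ((mat (x a))$i$2 + \<beta> a$i$2) * ((mat (x b))$2$j + \<beta> b$2$j))
          = h * (h * (2 * ((mat (x (a \<otimes> b)))$i$j + \<beta> (a \<otimes> b)$i$j)))" by (simp add: mult.assoc)
      thus ?thesis unfolding h by (simp add: \<rho>_def algebra_simps)
    qed
    thus ?thesis by (simp add: vec_eq_iff matrix_matrix_mult_def sum_2)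
  qed
  have det: "det (\<rho> a) = 1" if S: "a \<in> S" for a
  proof -
    have ent: "\<rho> a$2$2 = x a - \<rho> a$1$1" using tr[OF S] by (simp add: trace_def sum_2 algebra_simps)
    have "\<rho> (a \<otimes> a)$1$1 + \<rho> (a \<otimes> a)$2$2 = x a * x a - 2"
      using tr[of "a \<otimes> a"] S x_square[OF S] by (simp add: trace_def sum_2)
    hence "(\<rho> a ** \<rho> a)$1$1 + (\<rho> a ** \<rho> a)$2$2 = x a * x a - 2"
      using hom[OF S S] by simp
    hence "2 * (\<rho> a$1$1 * \<rho> a$2$2 - \<rho> a$1$2 * \<rho> a$2$1) = 2 * 1"
      by (simp add: matrix_matrix_mult_def sum_2 ent algebra_simps)
    hence "\<rho> a$1$1 * \<rho> a$2$2 - \<rho> a$1$2 * \<rho> a$2$1 = 1" by (metis h)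
    thus ?thesis by (simp add: det_2)
  qed
  have "\<rho> \<in> hom G SL2" using det hom by (auto simp: hom_def SL2_def)
  thus ?thesis using tr by blast
qed

text \<open>
  Without volume, \<open>2 x(abc)\<close> is determined by the values of \<open>x\<close> at shorter products. Computing
  \<open>x(abcd)\<close> in this way by grouping \<open>ab\<close> or \<open>bc\<close> together, the two results differ by a
  constant multiple of a minor of size 2 of the form, which therefore vanishes. This is the abelian case: the form is
  \<open>t^n \<alpha>(a) \<alpha>(b)\<close>, and all matrices lie in the commutative algebra generated over the power series
  by one matrix with square \<open>t^n\<close>. If \<open>n\<close> is odd, this matrix has no eigenvalue in the
  field of Laurent series.
\<close>

lemma representation_if_volume_zero:
  assumes vol0: "\<And>a b c. \<lbrakk>a \<in> S; b \<in> S; c \<in> S\<rbrakk> \<Longrightarrow> vol a b c = 0"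
  shows "\<exists>\<rho> \<in> hom G SL2. \<forall>a \<in> S. trace (\<rho> a) = x a"
proof -
  have tri: "2 * x (a \<otimes> b \<otimes> c) = x a * x (b \<otimes> c) + x b * x (a \<otimes> c) + x c * x (a \<otimes> b) - x a * x b * x c"
    if "a \<in> S" "b \<in> S" "c \<in> S" for a b c
    using vol0[OF that] by (simp add: trace_volume_def algebra_simps)
  have "minor2 form a c b d = 0" if S: "a \<in> S" "b \<in> S" "c \<in> S" "d \<in> S" for a b c d
  proof -
    have 1: "2 * x (a \<otimes> b \<otimes> c \<otimes> d) = x (a \<otimes> b) * x (c \<otimes> d) + x c * x (a \<otimes> b \<otimes> d)
        + x d * x (a \<otimes> b \<otimes> c) - x (a \<otimes> b) * x c * x d"
      using tri[of "a \<otimes> b" c d] S by (simp add: m_assoc)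
    have 2: "2 * x (a \<otimes> b \<otimes> c \<otimes> d) = x a * x (b \<otimes> c \<otimes> d) + x (b \<otimes> c) * x (a \<otimes> d)
        + x d * x (a \<otimes> b \<otimes> c) - x a * x (b \<otimes> c) * x d"
      using tri[of a "b \<otimes> c" d] S by (simp add: m_assoc)
    have "x c * x (a \<otimes> b \<otimes> d) + x (a \<otimes> b) * x (c \<otimes> d) - x (a \<otimes> b) * x c * x d
        = x a * x (b \<otimes> c \<otimes> d) + x (b \<otimes> c) * x (a \<otimes> d) - x a * x (b \<otimes> c) * x d"
      using trans[OF 1[symmetric] 2] by (simp add: algebra_simps)
    from arg_cong[OF this, of "\<lambda>z. 2 * z"]
    have "x c * (2 * x (a \<otimes> b \<otimes> d)) + 2 * x (a \<otimes> b) * x (c \<otimes> d) - 2 * x (a \<otimes> b) * x c * x d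
        = x a * (2 * x (b \<otimes> c \<otimes> d)) + 2 * x (b \<otimes> c) * x (a \<otimes> d) - 2 * x a * x (b \<otimes> c) * x d"
      by (simp add: algebra_simps)
    hence "2 * (x (a \<otimes> b) * x (c \<otimes> d)) - x a * x b * x (c \<otimes> d) - x c * x d * x (a \<otimes> b)
        = 2 * (x (b \<otimes> c) * x (a \<otimes> d)) - x a * x d * x (b \<otimes> c) - x b * x c * x (a \<otimes> d)"
      unfolding tri[OF S(1,2,4)] tri[OF S(2,3,4)] by (simp add: algebra_simps)
    from arg_cong[OF this, of "\<lambda>z. 2 * z"]
    have "form a b * form c d = form a d * form b c"
      unfolding trace_form_def by (simp add: algebra_simps)
    thus ?thesis using form_sym S by (simp add: minor2_def)
  qed
  hence "minors2_vanish S form" by (simp add: minors2_vanish_def)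
  with form_sym obtain n \<alpha> where \<alpha>: "\<And>a b. a \<in> S \<Longrightarrow> b \<in> S \<Longrightarrow> form a b = fps_X ^ n * \<alpha> a * \<alpha> b"
    by (rule fps_diagonalise1) blast
  have mult: "2 * \<alpha> (a \<otimes> b) = x a * \<alpha> b + x b * \<alpha> a" if S: "a \<in> S" "b \<in> S" for a b
  proof (cases "\<forall>c\<in>S. \<alpha> c = 0")
    case True
    then show ?thesis using S by simp
  next
    case False
    then obtain c where c: "c \<in> S" "\<alpha> c \<noteq> 0" by blast
    have "fps_X ^ n * \<alpha> c * (2 * \<alpha> (a \<otimes> b)) = fps_X ^ n * \<alpha> c * (x a * \<alpha> b + x b * \<alpha> a)"
      using form_mult[OF S c(1)] vol0[OF S c(1)] S c by (simp add: \<alpha> algebra_simps)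
    thus ?thesis using c(2) by simp
  qed
  define \<beta> :: "'g \<Rightarrow> complex fps^2^2"
    where "\<beta> a = vector [vector [0, \<alpha> a], vector [fps_X ^ n * \<alpha> a, 0]]" for a
  show ?thesis
  proof (rule representation_from_pure_part[of \<beta>])
    show "trace (\<beta> a) = 0" for a by (simp add: \<beta>_def mat2_simps)
    show "\<beta> a ** \<beta> b = (\<chi> i j. (mat (form a b))$i$j + 2 * \<beta> (a \<otimes> b)$i$j - x a * \<beta> b$i$j - x b * \<beta> a$i$j)"
      if "a \<in> S" "b \<in> S" for a b
    proof -
      have "2 * (fps_X ^ n * \<alpha> (a \<otimes> b)) = fps_X ^ n * (x a * \<alpha> b + x b * \<alpha> a)"
        unfolding mult[OF that, symmetric] by (simp add: algebra_simps)
      thus ?thesis using mult[OF that] by (simp add: \<beta>_def mat2_simps \<alpha>[OF that] algebra_simps)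
    qed
  qed
qed

end

section \<open>Pauli matrices over power series\<close>

text \<open>
  An anticommuting triple with squares \<open>t^n1\<close>, \<open>t^n2\<close>, \<open>t^n3\<close>. The even exponent allows the first
  matrix to be diagonal; the other two are then antidiagonal, and since \<open>n2\<close> and \<open>n3\<close> have the
  same parity, both can be made integral by placing the excess factor \<open>t^e\<close> below the diagonal. The
  products of two of the matrices are given only after multiplication by a power of \<open>t\<close>, because
  \<open>M - n1\<close>, \<open>M - n2\<close> or \<open>M - n3\<close> may be negative.
\<close>

lemma pauli_even:
  assumes "even n1" "n1 + n2 + n3 = 2 * M" and \<epsilon>: "\<epsilon> * \<epsilon> = -1"
  obtains M1 M2 M3 :: "complex fps^2^2" where
    "trace M1 = 0" "trace M2 = 0" "trace M3 = 0"
    "M1 ** M1 = mat (fps_X ^ n1)" "M2 ** M2 = mat (fps_X ^ n2)" "M3 ** M3 = mat (fps_X ^ n3)"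
    "M2 ** M1 = - (M1 ** M2)" "M3 ** M2 = - (M2 ** M3)" "M1 ** M3 = - (M3 ** M1)"
    "\<And>i j. fps_X ^ n3 * (M1 ** M2)$i$j = \<epsilon> * fps_X ^ M * M3$i$j"
    "\<And>i j. fps_X ^ n1 * (M2 ** M3)$i$j = \<epsilon> * fps_X ^ M * M1$i$j"
    "\<And>i j. fps_X ^ n2 * (M3 ** M1)$i$j = \<epsilon> * fps_X ^ M * M2$i$j"
proof -
  define e where "e = n2 mod 2"
  define k where "k = n2 div 2"
  obtain m where n1: "n1 = m + m" using evenE[OF assms(1)] unfolding mult_2 by blast
  have n2: "n2 = k + (k + e)" unfolding k_def e_def using div_mult_mod_eq[of n2 2] by linarith
  have "(n3 + e) mod 2 = 0" using assms(2) unfolding n1 n2 by presburger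
  hence "n3 mod 2 = e" unfolding e_def by presburger
  hence "n3 = n3 div 2 + (n3 div 2 + e)" using div_mult_mod_eq[of n3 2] by linarith
  then obtain l where n3: "n3 = l + (l + e)" by blast
  have M: "M = m + (k + (l + e))" using assms(2) n1 n2 n3 by simp
  define M1 M2 M3 :: "complex fps^2^2"
    where "M1 = vector [vector [fps_X ^ m, 0], vector [0, - (fps_X ^ m)]]"
      and "M2 = vector [vector [0, fps_X ^ k], vector [fps_X ^ (k + e), 0]]"
      and "M3 = vector [vector [0, - (\<epsilon> * fps_X ^ l)], vector [\<epsilon> * fps_X ^ (l + e), 0]]"
  have \<epsilon>': "\<epsilon> * (\<epsilon> * y) = - y" for y using \<epsilon> by (metis mult.assoc mult_minus1)
  note defs = M1_def M2_def M3_def mat2_simps n1 n2 n3 M power_add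
  show ?thesis
  proof (rule that[of M1 M2 M3])
    show "fps_X ^ n3 * (M1 ** M2)$i$j = \<epsilon> * fps_X ^ M * M3$i$j" for i j
      using exhaust_2[of i] exhaust_2[of j] by (auto simp: defs mult_ac \<epsilon>')
    show "fps_X ^ n1 * (M2 ** M3)$i$j = \<epsilon> * fps_X ^ M * M1$i$j" for i j
      using exhaust_2[of i] exhaust_2[of j] by (auto simp: defs mult_ac \<epsilon>')
    show "fps_X ^ n2 * (M3 ** M1)$i$j = \<epsilon> * fps_X ^ M * M2$i$j" for i j
      using exhaust_2[of i] exhaust_2[of j] by (auto simp: defs mult_ac \<epsilon>')
    show "trace M1 = 0" by (simp add: defs)
    show "trace M2 = 0" by (simp add: defs)
    show "trace M3 = 0" by (simp add: defs)
    show "M1 ** M1 = mat (fps_X ^ n1)" by (simp add: defs)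
    show "M2 ** M2 = mat (fps_X ^ n2)" by (simp add: defs mult_ac)
    show "M3 ** M3 = mat (fps_X ^ n3)" by (simp add: defs mult_ac \<epsilon>')
    show "M2 ** M1 = - (M1 ** M2)" by (simp add: defs mult_ac)
    show "M3 ** M2 = - (M2 ** M3)" by (simp add: defs mult_ac)
    show "M1 ** M3 = - (M3 ** M1)" by (simp add: defs mult_ac)
  qed
qed

text \<open>
  As the sum of the exponents is even, one of them is even, and the relations are invariant under
  cyclic permutations of the three matrices.
\<close>

lemma pauli:
  assumes sum: "n1 + n2 + n3 = 2 * M" and \<epsilon>: "\<epsilon> * \<epsilon> = -1"
  obtains M1 M2 M3 :: "complex fps^2^2" where
    "trace M1 = 0" "trace M2 = 0" "trace M3 = 0"
    "M1 ** M1 = mat (fps_X ^ n1)" "M2 ** M2 = mat (fps_X ^ n2)" "M3 ** M3 = mat (fps_X ^ n3)"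
    "M2 ** M1 = - (M1 ** M2)" "M3 ** M2 = - (M2 ** M3)" "M1 ** M3 = - (M3 ** M1)"
    "\<And>i j. fps_X ^ n3 * (M1 ** M2)$i$j = \<epsilon> * fps_X ^ M * M3$i$j"
    "\<And>i j. fps_X ^ n1 * (M2 ** M3)$i$j = \<epsilon> * fps_X ^ M * M1$i$j"
    "\<And>i j. fps_X ^ n2 * (M3 ** M1)$i$j = \<epsilon> * fps_X ^ M * M2$i$j"
proof -
  have "even (n1 + n2 + n3)" unfolding sum by simp
  then consider "even n1" | "even n2" | "even n3" by auto
  thus ?thesis
  proof cases
    case 1
    show ?thesis by (rule pauli_even[OF 1 sum \<epsilon>], rule that)
  next
    case 2
    have "n2 + n3 + n1 = 2 * M" using sum by simp
    from pauli_even[OF 2 this \<epsilon>] obtain M1 M2 M3 :: "complex fps^2^2" where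
      *: "trace M1 = 0" "trace M2 = 0" "trace M3 = 0"
      "M1 ** M1 = mat (fps_X ^ n2)" "M2 ** M2 = mat (fps_X ^ n3)" "M3 ** M3 = mat (fps_X ^ n1)"
      "M2 ** M1 = - (M1 ** M2)" "M3 ** M2 = - (M2 ** M3)" "M1 ** M3 = - (M3 ** M1)"
      "\<And>i j. fps_X ^ n1 * (M1 ** M2)$i$j = \<epsilon> * fps_X ^ M * M3$i$j"
      "\<And>i j. fps_X ^ n2 * (M2 ** M3)$i$j = \<epsilon> * fps_X ^ M * M1$i$j"
      "\<And>i j. fps_X ^ n3 * (M3 ** M1)$i$j = \<epsilon> * fps_X ^ M * M2$i$j" by metis
    show ?thesis by (rule that[of M3 M1 M2]) (fact *)+
  next
    case 3
    have "n3 + n1 + n2 = 2 * M" using sum by simp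
    from pauli_even[OF 3 this \<epsilon>] obtain M1 M2 M3 :: "complex fps^2^2" where
      *: "trace M1 = 0" "trace M2 = 0" "trace M3 = 0"
      "M1 ** M1 = mat (fps_X ^ n3)" "M2 ** M2 = mat (fps_X ^ n1)" "M3 ** M3 = mat (fps_X ^ n2)"
      "M2 ** M1 = - (M1 ** M2)" "M3 ** M2 = - (M2 ** M3)" "M1 ** M3 = - (M3 ** M1)"
      "\<And>i j. fps_X ^ n2 * (M1 ** M2)$i$j = \<epsilon> * fps_X ^ M * M3$i$j"
      "\<And>i j. fps_X ^ n3 * (M2 ** M3)$i$j = \<epsilon> * fps_X ^ M * M1$i$j"
      "\<And>i j. fps_X ^ n1 * (M3 ** M1)$i$j = \<epsilon> * fps_X ^ M * M2$i$j" by metis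
    show ?thesis by (rule that[of M2 M3 M1]) (fact *)+
  qed
qed

section \<open>Realising a character over the power series ring\<close>

context sl2_character
begin

text \<open>
  By the Gram identity, the cofactors of the first row are proportional to volumes, and the expansion
  along that row becomes Cramer's relation.
\<close>

lemma form_minors4_vanish: "minors4_vanish S form"
proof -
  have "minor4 form a b c d e f g h = 0"
    if S: "a \<in> S" "b \<in> S" "c \<in> S" "d \<in> S" "e \<in> S" "f \<in> S" "g \<in> S" "h \<in> S"
    for a b c d e f g h
  proof -
    have m: "minor3 form b c d u v w = - (4 * vol b c d) * vol u v w"
      if "u \<in> S" "v \<in> S" "w \<in> S" for u v w
      using volume_gram[OF S(2-4) that] by simp
    have "minor4 form a b c d e f g h = - (4 * vol b c d) *
        (form a e * vol f g h - form a f * vol e g h + form a g * vol e f h - form a h * vol e f g)"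
      unfolding minor4_def m[OF S(6-8)] m[OF S(5,7,8)] m[OF S(5,6,8)] m[OF S(5-7)]
      by (simp add: algebra_simps)
    thus ?thesis using volume_cramer[OF S(1,5-8)] by simp
  qed
  thus ?thesis by (simp add: minors4_vanish_def)
qed

text \<open>
  This is the irreducible case. Diagonalising the form gives integral coordinates of the traceless
  parts; the Gram identity fixes the volume in these coordinates up to sign and forces the sum of the
  exponents to be even; then Pauli matrices with these exponents serve as a basis.
\<close>

lemma representation_if_volume_nonzero:
  assumes pqr: "p \<in> S" "q \<in> S" "r \<in> S" and vol0: "vol p q r \<noteq> 0"
  shows "\<exists>\<rho> \<in> hom G SL2. \<forall>a \<in> S. trace (\<rho> a) = x a"
proof -
  obtain n1 n2 n3 \<alpha>1 \<alpha>2 \<alpha>3 where form: "\<And>a b. a \<in> S \<Longrightarrow> b \<in> S \<Longrightarrow>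
      form a b = fps_X ^ n1 * \<alpha>1 a * \<alpha>1 b + fps_X ^ n2 * \<alpha>2 a * \<alpha>2 b + fps_X ^ n3 * \<alpha>3 a * \<alpha>3 b"
    using fps_diagonalise3[OF form_sym form_minors4_vanish] by metis
  define D where "D a b c = \<alpha>1 a * (\<alpha>2 b * \<alpha>3 c - \<alpha>3 b * \<alpha>2 c)
      - \<alpha>2 a * (\<alpha>1 b * \<alpha>3 c - \<alpha>3 b * \<alpha>1 c) + \<alpha>3 a * (\<alpha>1 b * \<alpha>2 c - \<alpha>2 b * \<alpha>1 c)" for a b c
  define t1 t2 t3 :: "complex fps" where "t1 = fps_X ^ n1" and "t2 = fps_X ^ n2" and "t3 = fps_X ^ n3"
  have t: "t1 \<noteq> 0" "t2 \<noteq> 0" "t3 \<noteq> 0" by (simp_all add: t1_def t2_def t3_def)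
  note form = form[folded t1_def t2_def t3_def]
  have gram: "4 * vol a b c * vol e f g = - (t1 * t2 * t3 * D a b c * D e f g)"
    if S: "a \<in> S" "b \<in> S" "c \<in> S" "e \<in> S" "f \<in> S" "g \<in> S" for a b c e f g
  proof -
    have "minor3 form a b c e f g = t1 * t2 * t3 * D a b c * D e f g"
      unfolding minor3_def minor2_def D_def
        form[OF S(1,4)] form[OF S(1,5)] form[OF S(1,6)] form[OF S(2,4)] form[OF S(2,5)]
        form[OF S(2,6)] form[OF S(3,4)] form[OF S(3,5)] form[OF S(3,6)]
      by (simp add: algebra_simps)
    thus ?thesis using volume_gram[OF S] by simp
  qed
  define T0 where "T0 = vol p q r"
  define D0 where "D0 = D p q r"
  have sq: "4 * T0 * T0 = - (t1 * t2 * t3 * D0 * D0)"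
    unfolding T0_def D0_def using gram pqr by blast
  have T0: "T0 \<noteq> 0" using vol0 by (simp add: T0_def)
  have "4 * T0 * T0 \<noteq> 0" using T0 by simp
  hence D0: "D0 \<noteq> 0" using sq by auto
  \<comment> \<open>Comparing valuations in the Gram identity shows that the sum of the exponents is even.\<close>
  have "subdegree (4 * T0 * T0) = subdegree T0 + subdegree T0"
    using T0 by (simp add: subdegree_mult)
  moreover have "subdegree (- (t1 * t2 * t3 * D0 * D0)) = n1 + n2 + n3 + (subdegree D0 + subdegree D0)"
    using D0 t by (simp add: subdegree_mult t1_def t2_def t3_def)
  ultimately have "n1 + n2 + n3 + 2 * subdegree D0 = 2 * subdegree T0" using sq by simp
  hence "even (n1 + n2 + n3)" by presburger
  then obtain M where M: "n1 + n2 + n3 = 2 * M" by (elim evenE)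
  define s :: "complex fps" where "s = fps_X ^ M"
  have s: "s \<noteq> 0" by (simp add: s_def)
  have ss: "t1 * t2 * t3 = s * s"
    unfolding t1_def t2_def t3_def s_def power_add[symmetric] M mult_2 ..
  define I where "I = fps_const \<i>"
  have I: "I * I = -1" by (simp add: I_def fps_const_neg[symmetric] del: fps_const_neg)
  have "(2 * T0 - I * s * D0) * (2 * T0 + I * s * D0) = 4 * T0 * T0 - (I * I) * (s * s * D0 * D0)"
    by (simp add: algebra_simps)
  also have "\<dots> = 0" unfolding sq ss I by simp
  \<comment> \<open>The ring is a domain, so one of the two square roots of -1 can be chosen as \<open>\<epsilon>\<close>.\<close>
  finally have "2 * T0 = I * s * D0 \<or> 2 * T0 = (- I) * s * D0"
    by (auto simp: eq_neg_iff_add_eq_0)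
  moreover have "(- I) * (- I) = -1" using I by simp
  ultimately obtain \<epsilon> where \<epsilon>: "\<epsilon> * \<epsilon> = -1" and T0D0: "2 * T0 = \<epsilon> * s * D0" using I by blast
  have \<epsilon>0: "\<epsilon> \<noteq> 0" using \<epsilon> by auto
  have vol: "2 * vol a b c = \<epsilon> * s * D a b c" if S: "a \<in> S" "b \<in> S" "c \<in> S" for a b c
  proof -
    have "(\<epsilon> * s * D0) * (2 * vol a b c) = 4 * vol a b c * T0"
      unfolding T0D0[symmetric] by (simp add: algebra_simps)
    also have "\<dots> = (\<epsilon> * \<epsilon>) * (s * s * D a b c * D0)"
      unfolding T0_def gram[OF S pqr] ss \<epsilon> D0_def by simp
    also have "\<dots> = (\<epsilon> * s * D0) * (\<epsilon> * s * D a b c)" by (simp add: algebra_simps)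
    finally show ?thesis using \<epsilon>0 s D0 by simp
  qed
  have coords: "t1 * (2 * \<alpha>1 (a \<otimes> b) - x a * \<alpha>1 b - x b * \<alpha>1 a) = \<epsilon> * s * (\<alpha>2 a * \<alpha>3 b - \<alpha>3 a * \<alpha>2 b)"
      "t2 * (2 * \<alpha>2 (a \<otimes> b) - x a * \<alpha>2 b - x b * \<alpha>2 a) = \<epsilon> * s * (\<alpha>3 a * \<alpha>1 b - \<alpha>1 a * \<alpha>3 b)"
      "t3 * (2 * \<alpha>3 (a \<otimes> b) - x a * \<alpha>3 b - x b * \<alpha>3 a) = \<epsilon> * s * (\<alpha>1 a * \<alpha>2 b - \<alpha>2 a * \<alpha>1 b)"
    if S: "a \<in> S" "b \<in> S" for a b
  proof -
    \<comment> \<open>The defects \<open>z1\<close>, \<open>z2\<close>, \<open>z3\<close> are orthogonal to the coordinate vectors of all elements, and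
      those of \<open>p\<close>, \<open>q\<close>, \<open>r\<close> are linearly independent.\<close>
    define z1 where "z1 = t1 * (2 * \<alpha>1 (a \<otimes> b) - x a * \<alpha>1 b - x b * \<alpha>1 a) - \<epsilon> * s * (\<alpha>2 a * \<alpha>3 b - \<alpha>3 a * \<alpha>2 b)"
    define z2 where "z2 = t2 * (2 * \<alpha>2 (a \<otimes> b) - x a * \<alpha>2 b - x b * \<alpha>2 a) - \<epsilon> * s * (\<alpha>3 a * \<alpha>1 b - \<alpha>1 a * \<alpha>3 b)"
    define z3 where "z3 = t3 * (2 * \<alpha>3 (a \<otimes> b) - x a * \<alpha>3 b - x b * \<alpha>3 a) - \<epsilon> * s * (\<alpha>1 a * \<alpha>2 b - \<alpha>2 a * \<alpha>1 b)"
    have z: "z1 * \<alpha>1 c + z2 * \<alpha>2 c + z3 * \<alpha>3 c = 0" if c: "c \<in> S" for c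
    proof -
      have "z1 * \<alpha>1 c + z2 * \<alpha>2 c + z3 * \<alpha>3 c
          = 2 * form (a \<otimes> b) c - (x a * form b c + x b * form a c + \<epsilon> * s * D a b c)"
        unfolding z1_def z2_def z3_def D_def form[OF m_closed[OF S] c] form[OF S(1) c] form[OF S(2) c]
        by (simp add: algebra_simps)
      also have "\<dots> = 0" using form_mult[OF S c] vol[OF S c] by simp
      finally show ?thesis .
    qed
    have "D0 * z1 = (z1 * \<alpha>1 p + z2 * \<alpha>2 p + z3 * \<alpha>3 p) * (\<alpha>2 q * \<alpha>3 r - \<alpha>3 q * \<alpha>2 r)
        - (z1 * \<alpha>1 q + z2 * \<alpha>2 q + z3 * \<alpha>3 q) * (\<alpha>2 p * \<alpha>3 r - \<alpha>3 p * \<alpha>2 r)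
        + (z1 * \<alpha>1 r + z2 * \<alpha>2 r + z3 * \<alpha>3 r) * (\<alpha>2 p * \<alpha>3 q - \<alpha>3 p * \<alpha>2 q)"
      unfolding D0_def D_def by (simp add: algebra_simps)
    moreover have "D0 * z2 = (z1 * \<alpha>1 p + z2 * \<alpha>2 p + z3 * \<alpha>3 p) * (\<alpha>3 q * \<alpha>1 r - \<alpha>1 q * \<alpha>3 r)
        - (z1 * \<alpha>1 q + z2 * \<alpha>2 q + z3 * \<alpha>3 q) * (\<alpha>3 p * \<alpha>1 r - \<alpha>1 p * \<alpha>3 r)
        + (z1 * \<alpha>1 r + z2 * \<alpha>2 r + z3 * \<alpha>3 r) * (\<alpha>3 p * \<alpha>1 q - \<alpha>1 p * \<alpha>3 q)"
      unfolding D0_def D_def by (simp add: algebra_simps)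
    moreover have "D0 * z3 = (z1 * \<alpha>1 p + z2 * \<alpha>2 p + z3 * \<alpha>3 p) * (\<alpha>1 q * \<alpha>2 r - \<alpha>2 q * \<alpha>1 r)
        - (z1 * \<alpha>1 q + z2 * \<alpha>2 q + z3 * \<alpha>3 q) * (\<alpha>1 p * \<alpha>2 r - \<alpha>2 p * \<alpha>1 r)
        + (z1 * \<alpha>1 r + z2 * \<alpha>2 r + z3 * \<alpha>3 r) * (\<alpha>1 p * \<alpha>2 q - \<alpha>2 p * \<alpha>1 q)"
      unfolding D0_def D_def by (simp add: algebra_simps)
    ultimately have "D0 * z1 = 0" "D0 * z2 = 0" "D0 * z3 = 0"
      by (simp_all only: z[OF pqr(1)] z[OF pqr(2)] z[OF pqr(3)] mult_zero_left diff_self add_0_right)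
    hence "z1 = 0" "z2 = 0" "z3 = 0" using D0 by simp_all
    thus "t1 * (2 * \<alpha>1 (a \<otimes> b) - x a * \<alpha>1 b - x b * \<alpha>1 a) = \<epsilon> * s * (\<alpha>2 a * \<alpha>3 b - \<alpha>3 a * \<alpha>2 b)"
      "t2 * (2 * \<alpha>2 (a \<otimes> b) - x a * \<alpha>2 b - x b * \<alpha>2 a) = \<epsilon> * s * (\<alpha>3 a * \<alpha>1 b - \<alpha>1 a * \<alpha>3 b)"
      "t3 * (2 * \<alpha>3 (a \<otimes> b) - x a * \<alpha>3 b - x b * \<alpha>3 a) = \<epsilon> * s * (\<alpha>1 a * \<alpha>2 b - \<alpha>2 a * \<alpha>1 b)"
      unfolding z1_def z2_def z3_def by simp_all
  qed
  obtain M1 M2 M3 :: "complex fps^2^2" where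
    trace0: "trace M1 = 0" "trace M2 = 0" "trace M3 = 0" and
    sqs: "M1 ** M1 = mat t1" "M2 ** M2 = mat t2" "M3 ** M3 = mat t3" and
    anti: "M2 ** M1 = - (M1 ** M2)" "M3 ** M2 = - (M2 ** M3)" "M1 ** M3 = - (M3 ** M1)" and
    prods: "\<And>i j. t3 * (M1 ** M2)$i$j = \<epsilon> * s * M3$i$j"
      "\<And>i j. t1 * (M2 ** M3)$i$j = \<epsilon> * s * M1$i$j"
      "\<And>i j. t2 * (M3 ** M1)$i$j = \<epsilon> * s * M2$i$j"
    using pauli[OF M \<epsilon>] unfolding t1_def t2_def t3_def s_def by metis
  define \<beta> where "\<beta> a = (\<chi> i j. \<alpha>1 a * M1$i$j + \<alpha>2 a * M2$i$j + \<alpha>3 a * M3$i$j)" for a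
  show ?thesis
  proof (rule representation_from_pure_part[of \<beta>])
    show "trace (\<beta> a) = 0" for a
    proof -
      have "M1$2$2 = - M1$1$1" "M2$2$2 = - M2$1$1" "M3$2$2 = - M3$1$1"
        using trace0 by (simp_all add: trace_def sum_2 add_eq_0_iff)
      thus ?thesis by (simp add: \<beta>_def trace_def sum_2)
    qed
    show "\<beta> a ** \<beta> b = (\<chi> i j. (mat (form a b))$i$j + 2 * \<beta> (a \<otimes> b)$i$j - x a * \<beta> b$i$j - x b * \<beta> a$i$j)"
      if S: "a \<in> S" "b \<in> S" for a b
    proof -
      \<comment> \<open>The relations for coordinates and for matrices are both known up to a power of \<open>t\<close> only; in
        each summand the two powers agree and cancel.\<close>
      have c3: "(2 * \<alpha>3 (a \<otimes> b) - x a * \<alpha>3 b - x b * \<alpha>3 a) * M3$i$j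
          = (\<alpha>1 a * \<alpha>2 b - \<alpha>2 a * \<alpha>1 b) * (M1 ** M2)$i$j" for i j
      proof -
        have "t3 * ((2 * \<alpha>3 (a \<otimes> b) - x a * \<alpha>3 b - x b * \<alpha>3 a) * M3$i$j)
            = (\<epsilon> * s * M3$i$j) * (\<alpha>1 a * \<alpha>2 b - \<alpha>2 a * \<alpha>1 b)"
          unfolding mult.assoc[symmetric] coords(3)[OF S] by (simp add: mult_ac)
        also have "\<dots> = t3 * ((\<alpha>1 a * \<alpha>2 b - \<alpha>2 a * \<alpha>1 b) * (M1 ** M2)$i$j)"
          unfolding prods[symmetric] by (simp add: mult_ac)
        finally show ?thesis using t by simp
      qed
      have c1: "(2 * \<alpha>1 (a \<otimes> b) - x a * \<alpha>1 b - x b * \<alpha>1 a) * M1$i$j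
          = (\<alpha>2 a * \<alpha>3 b - \<alpha>3 a * \<alpha>2 b) * (M2 ** M3)$i$j" for i j
      proof -
        have "t1 * ((2 * \<alpha>1 (a \<otimes> b) - x a * \<alpha>1 b - x b * \<alpha>1 a) * M1$i$j)
            = (\<epsilon> * s * M1$i$j) * (\<alpha>2 a * \<alpha>3 b - \<alpha>3 a * \<alpha>2 b)"
          unfolding mult.assoc[symmetric] coords(1)[OF S] by (simp add: mult_ac)
        also have "\<dots> = t1 * ((\<alpha>2 a * \<alpha>3 b - \<alpha>3 a * \<alpha>2 b) * (M2 ** M3)$i$j)"
          unfolding prods[symmetric] by (simp add: mult_ac)
        finally show ?thesis using t by simp
      qed
      have c2: "(2 * \<alpha>2 (a \<otimes> b) - x a * \<alpha>2 b - x b * \<alpha>2 a) * M2$i$j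
          = (\<alpha>3 a * \<alpha>1 b - \<alpha>1 a * \<alpha>3 b) * (M3 ** M1)$i$j" for i j
      proof -
        have "t2 * ((2 * \<alpha>2 (a \<otimes> b) - x a * \<alpha>2 b - x b * \<alpha>2 a) * M2$i$j)
            = (\<epsilon> * s * M2$i$j) * (\<alpha>3 a * \<alpha>1 b - \<alpha>1 a * \<alpha>3 b)"
          unfolding mult.assoc[symmetric] coords(2)[OF S] by (simp add: mult_ac)
        also have "\<dots> = t2 * ((\<alpha>3 a * \<alpha>1 b - \<alpha>1 a * \<alpha>3 b) * (M3 ** M1)$i$j)"
          unfolding prods[symmetric] by (simp add: mult_ac)
        finally show ?thesis using t by simp
      qed
      have "(\<beta> a ** \<beta> b)$i$j = (mat (form a b))$i$j + 2 * \<beta> (a \<otimes> b)$i$j - x a * \<beta> b$i$j - x b * \<beta> a$i$j" for i j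
      proof -
        have "(\<beta> a ** \<beta> b)$i$j = \<alpha>1 a * \<alpha>1 b * (M1 ** M1)$i$j + \<alpha>2 a * \<alpha>2 b * (M2 ** M2)$i$j
            + \<alpha>3 a * \<alpha>3 b * (M3 ** M3)$i$j
            + \<alpha>1 a * \<alpha>2 b * (M1 ** M2)$i$j + \<alpha>2 a * \<alpha>1 b * (M2 ** M1)$i$j
            + \<alpha>2 a * \<alpha>3 b * (M2 ** M3)$i$j + \<alpha>3 a * \<alpha>2 b * (M3 ** M2)$i$j
            + \<alpha>3 a * \<alpha>1 b * (M3 ** M1)$i$j + \<alpha>1 a * \<alpha>3 b * (M1 ** M3)$i$j"
          by (simp add: \<beta>_def matrix_matrix_mult_def sum_2 algebra_simps)
        also have "\<dots> = \<alpha>1 a * \<alpha>1 b * (mat t1)$i$j + \<alpha>2 a * \<alpha>2 b * (mat t2)$i$j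
            + \<alpha>3 a * \<alpha>3 b * (mat t3)$i$j
            + (\<alpha>1 a * \<alpha>2 b - \<alpha>2 a * \<alpha>1 b) * (M1 ** M2)$i$j
            + (\<alpha>2 a * \<alpha>3 b - \<alpha>3 a * \<alpha>2 b) * (M2 ** M3)$i$j
            + (\<alpha>3 a * \<alpha>1 b - \<alpha>1 a * \<alpha>3 b) * (M3 ** M1)$i$j"
          unfolding sqs anti by (simp add: algebra_simps)
        also have "\<dots> = (mat (form a b))$i$j + 2 * \<beta> (a \<otimes> b)$i$j - x a * \<beta> b$i$j - x b * \<beta> a$i$j"
          unfolding c1[symmetric] c2[symmetric] c3[symmetric] form[OF S]
          by (simp add: \<beta>_def mat_def algebra_simps)
        finally show ?thesis .
      qed
      thus ?thesis by (simp add: vec_eq_iff)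
    qed
  qed
qed

theorem exists_representation: "\<exists>\<rho> \<in> hom G SL2. \<forall>a \<in> S. trace (\<rho> a) = x a"
  using representation_if_volume_zero representation_if_volume_nonzero by blast

end

section \<open>Substitutions and the conjugation action\<close>

text \<open>
  The inner product in the substitution homomorphism, separated so that multiplicativity can be
  checked on monomials.
\<close>

definition monomial_value :: "('n \<times> 2 \<times> 2 \<Rightarrow> 'n entry_poly) \<Rightarrow> ('n \<times> 2 \<times> 2 \<Rightarrow>\<^sub>0 nat) \<Rightarrow> 'n entry_poly"
  where "monomial_value \<sigma> m = (\<Prod>v\<in>Poly_Mapping.keys m. \<sigma> v ^ Poly_Mapping.lookup m v)"

lemma monomial_value_superset:
  assumes "finite K" "Poly_Mapping.keys m \<subseteq> K"
  shows "monomial_value \<sigma> m = (\<Prod>v\<in>K. \<sigma> v ^ Poly_Mapping.lookup m v)"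
  unfolding monomial_value_def using assms
  by (intro prod.mono_neutral_left) (auto simp: in_keys_iff)

lemma monomial_value_add: "monomial_value \<sigma> (m + m') = monomial_value \<sigma> m * monomial_value \<sigma> m'"
proof -
  define K where "K = Poly_Mapping.keys m \<union> Poly_Mapping.keys m'"
  have K: "finite K" "Poly_Mapping.keys m \<subseteq> K" "Poly_Mapping.keys m' \<subseteq> K"
    "Poly_Mapping.keys (m + m') \<subseteq> K"
    by (auto simp: K_def dest: subsetD[OF Poly_Mapping.keys_add])
  show ?thesis
    using K by (simp add: monomial_value_superset[of K] lookup_add power_add prod.distrib)
qed

lemma pconst_simps [simp]:
  "pconst 0 = 0" "pconst 1 = 1" "pconst (a + b) = pconst a + pconst b"
  "pconst (a * b) = pconst a * pconst b" "pconst (- a) = - pconst a"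
  by (simp_all add: pconst_def single_add mult_single single_uminus)

lemma psubst_superset:
  assumes "finite K" "Poly_Mapping.keys p \<subseteq> K"
  shows "psubst \<sigma> p = (\<Sum>m\<in>K. pconst (Poly_Mapping.lookup p m) * monomial_value \<sigma> m)"
  unfolding psubst_def monomial_value_def using assms
  by (intro sum.mono_neutral_left) (auto simp: in_keys_iff)

lemma psubst_add: "psubst \<sigma> (p + q) = psubst \<sigma> p + psubst \<sigma> q"
proof -
  define K where "K = Poly_Mapping.keys p \<union> Poly_Mapping.keys q"
  have K: "finite K" "Poly_Mapping.keys p \<subseteq> K" "Poly_Mapping.keys q \<subseteq> K"
    "Poly_Mapping.keys (p + q) \<subseteq> K"
    by (auto simp: K_def dest: subsetD[OF Poly_Mapping.keys_add])
  show ?thesis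
    using K by (simp add: psubst_superset[of K] lookup_add distrib_right sum.distrib)
qed

lemma psubst_single: "psubst \<sigma> (Poly_Mapping.single m c) = pconst c * monomial_value \<sigma> m"
  by (subst psubst_superset[of "{m}"]) auto

lemma poly_single_induct [case_names single add]:
  fixes p :: "'a \<Rightarrow>\<^sub>0 'b::comm_monoid_add"
  assumes "\<And>m c. P (Poly_Mapping.single m c)" and "\<And>p q. P p \<Longrightarrow> P q \<Longrightarrow> P (p + q)"
  shows "P p"
proof (induction p rule: update_induct)
  case const
  show ?case using assms(1)[of undefined 0] by simp
next
  case (update f a b)
  have "Poly_Mapping.update a b f = f + Poly_Mapping.single a b"
    using update(1) by (intro poly_mapping_eqI)
      (auto simp: lookup_update lookup_add lookup_single when_def in_keys_iff)
  thus ?case using assms update by simp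
qed

lemma psubst_mult: "psubst \<sigma> (p * q) = psubst \<sigma> p * psubst \<sigma> q"
proof (induction p rule: poly_single_induct)
  case (single m c)
  show ?case
    by (induction q rule: poly_single_induct)
      (simp_all add: mult_single psubst_single monomial_value_add psubst_add algebra_simps)
qed (simp add: psubst_add algebra_simps)

lemma psubst_pconst [simp]: "psubst \<sigma> (pconst c) = pconst c"
  using psubst_single[of \<sigma> 0 c] by (simp add: monomial_value_def flip: pconst_def)

lemma psubst_0 [simp]: "psubst \<sigma> 0 = 0" and psubst_1 [simp]: "psubst \<sigma> 1 = 1"
  using psubst_pconst[of \<sigma> 0] psubst_pconst[of \<sigma> 1] by (simp_all del: psubst_pconst)

lemma psubst_pvar [simp]: "psubst \<sigma> (pvar v) = \<sigma> v"
  by (simp add: pvar_def psubst_single monomial_value_def)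

lemma psubst_uminus: "psubst \<sigma> (- p) = - psubst \<sigma> p"
  by (metis add_eq_0_iff psubst_add psubst_0 right_minus)

lemma psubst_diff: "psubst \<sigma> (p - q) = psubst \<sigma> p - psubst \<sigma> q"
  by (metis diff_conv_add_uminus psubst_add psubst_uminus)

lemma psubst_power: "psubst \<sigma> (p ^ k) = psubst \<sigma> p ^ k"
  by (induction k) (simp_all add: psubst_mult)

lemma psubst_prod: "psubst \<sigma> (prod g K) = (\<Prod>v\<in>K. psubst \<sigma> (g v))"
  by (induction K rule: infinite_finite_induct) (simp_all add: psubst_mult)

text \<open>
  Together with the identity substitution below, this makes conjugation by \<open>g\<close> invertible on
  polynomials, with conjugation by the inverse matrix as inverse.
\<close>

lemma psubst_psubst: "psubst \<tau> (psubst \<sigma> p) = psubst (\<lambda>v. psubst \<tau> (\<sigma> v)) p"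
  by (induction p rule: poly_single_induct)
    (simp_all add: psubst_single psubst_add psubst_mult monomial_value_def psubst_prod psubst_power)

lemma monomial_value_pvar: "monomial_value pvar m = Poly_Mapping.single m 1"
proof (induction m rule: poly_single_induct)
  case (single v k)
  have "pvar v ^ k = Poly_Mapping.single (Poly_Mapping.single v k) 1"
    by (induction k) (simp_all add: pvar_def mult_single flip: single_add)
  thus ?case by (simp add: monomial_value_superset[of "{v}"])
qed (simp add: monomial_value_add mult_single)

lemma psubst_pvar_id: "psubst pvar p = p"
  by (induction p rule: poly_single_induct)
    (simp_all add: psubst_single psubst_add monomial_value_pvar pconst_def mult_single)

lemma map_matrix_mult:
  fixes A B :: "'a::comm_ring_1^2^2"
  assumes "\<And>p q. h (p + q) = h p + h q" "\<And>p q. h (p * q) = h p * (h q :: 'b::comm_ring_1)"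
  shows "map_matrix h (A ** B) = map_matrix h A ** map_matrix h B"
  by (simp add: vec_eq_iff matrix_matrix_mult_def sum_2 assms)

lemma map_matrix_pconst_mult: "map_matrix pconst (A ** B) = map_matrix pconst A ** map_matrix pconst B"
  for A B :: "complex^2^2"
  by (rule map_matrix_mult) simp_all

lemma map_matrix_pconst_one: "map_matrix pconst (mat 1) = mat 1"
  by (simp add: vec_eq_iff mat_def)

lemma adjugate2_mult: "adjugate2 (A ** B) = adjugate2 B ** adjugate2 A"
  by (simp add: adjugate2_def vec_eq_iff matrix_matrix_mult_def forall_2 sum_2 algebra_simps)

lemma adjugate2_inverse:
  "A ** adjugate2 A = mat (det A)" "adjugate2 A ** A = mat (det A)"
  by (simp_all add: adjugate2_def mat_def vec_eq_iff matrix_matrix_mult_def forall_2 sum_2 det_2 algebra_simps)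

lemma det_adjugate2: "det (adjugate2 A) = det A"
  by (simp add: adjugate2_def det_2 algebra_simps)

lemma adjugate2_adjugate2: "adjugate2 (adjugate2 A) = A"
  by (simp add: adjugate2_def vec_eq_iff forall_2)

lemma matrix_inv_SL2:
  fixes g :: "complex^2^2"
  assumes "det g = 1"
  shows "matrix_inv g = adjugate2 g" "matrix_inv g ** g = mat 1" "g ** matrix_inv g = mat 1"
proof -
  have "g ** adjugate2 g = mat 1" "adjugate2 g ** g = mat 1"
    using adjugate2_inverse[of g] assms by simp_all
  hence "\<exists>h. g ** h = mat 1 \<and> h ** g = mat 1" by blast
  hence "g ** matrix_inv g = mat 1 \<and> matrix_inv g ** g = mat 1"
    unfolding matrix_inv_def by (rule someI_ex)
  hence "g ** matrix_inv g = mat 1" ..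
  moreover have "matrix_inv g = (adjugate2 g ** g) ** matrix_inv g"
    using \<open>adjugate2 g ** g = mat 1\<close> by simp
  ultimately show *: "matrix_inv g = adjugate2 g"
    by (simp add: matrix_mul_assoc[symmetric])
  show "matrix_inv g ** g = mat 1" "g ** matrix_inv g = mat 1"
    using adjugate2_inverse[of g] assms * by simp_all
qed

lemma conj_poly_simps:
  "conj_poly g (p + q) = conj_poly g p + conj_poly g q"
  "conj_poly g (p * q) = conj_poly g p * conj_poly g q"
  "conj_poly g (p - q) = conj_poly g p - conj_poly g q"
  "conj_poly g (- p) = - conj_poly g p"
  "conj_poly g (pconst c) = pconst c" "conj_poly g 0 = 0" "conj_poly g 1 = 1"
  by (simp_all add: conj_poly_def psubst_add psubst_mult psubst_diff psubst_uminus)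

lemma map_conj_gen_matrix: "map_matrix (conj_poly g) (gen_matrix l)
    = map_matrix pconst (matrix_inv g) ** gen_matrix l ** map_matrix pconst g"
  by (simp add: vec_eq_iff conj_poly_def gen_matrix_def)

lemma map_conj_mult: "map_matrix (conj_poly g) (A ** B) = map_matrix (conj_poly g) A ** map_matrix (conj_poly g) B"
  for A B :: "'n entry_poly^2^2"
  by (rule map_matrix_mult) (simp_all add: conj_poly_simps)

lemma map_conj_pconst: "map_matrix (conj_poly g) (map_matrix pconst A) = map_matrix pconst A"
  by (simp add: vec_eq_iff conj_poly_simps)

text \<open>
  For matrices of determinant 1 the adjugate is the inverse, and taking adjugates reverses products, so
  letters standing for inverses are conjugated in the same way as the generators.
\<close>

lemma map_conj_word_matrix:
  assumes g: "det g = 1"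
  shows "map_matrix (conj_poly g) (word_matrix w)
    = map_matrix pconst (matrix_inv g) ** word_matrix w ** map_matrix pconst g"
proof -
  let ?C = "map_matrix pconst g" and ?D = "map_matrix pconst (matrix_inv g)"
  have CD: "?C ** ?D = mat 1" "?D ** ?C = mat 1"
    using matrix_inv_SL2[OF g] by (simp_all add: map_matrix_pconst_one flip: map_matrix_pconst_mult)
  have adj: "adjugate2 (map_matrix pconst A) = map_matrix pconst (adjugate2 A)" for A
    by (simp add: adjugate2_def vec_eq_iff forall_2)
  have "adjugate2 ?C = ?D" "adjugate2 ?D = ?C"
    using matrix_inv_SL2(1)[OF g] by (simp_all add: adj adjugate2_adjugate2)
  hence adjg: "map_matrix (conj_poly g) (adjugate2 (gen_matrix l)) = ?D ** adjugate2 (gen_matrix l) ** ?C" for l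
  proof -
    have "map_matrix (conj_poly g) (adjugate2 (gen_matrix l))
        = adjugate2 (map_matrix (conj_poly g) (gen_matrix l))"
      by (simp add: adjugate2_def vec_eq_iff forall_2 conj_poly_simps)
    also have "\<dots> = ?D ** adjugate2 (gen_matrix l) ** ?C"
      unfolding map_conj_gen_matrix adjugate2_mult \<open>adjugate2 ?C = ?D\<close> \<open>adjugate2 ?D = ?C\<close>
      by (simp add: matrix_mul_assoc)
    finally show ?thesis .
  qed
  have cancel: "(?D ** A ** ?C) ** (?D ** B ** ?C) = ?D ** (A ** B) ** ?C" for A B
  proof -
    have "(?D ** A ** ?C) ** (?D ** B ** ?C) = ?D ** A ** (?C ** ?D) ** B ** ?C"
      by (simp only: matrix_mul_assoc)
    thus ?thesis by (simp only: CD matrix_mul_rid matrix_mul_assoc)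
  qed
  show ?thesis
  proof (induction w)
    case Nil
    have "map_matrix (conj_poly g) (mat 1) = mat 1" by (simp add: vec_eq_iff mat_def conj_poly_simps)
    thus ?case by (simp add: word_matrix_def CD)
  next
    case (Cons le w)
    obtain l e where le: "le = (l, e)" by fastforce
    have "word_matrix (le # w) = (if e then gen_matrix l else adjugate2 (gen_matrix l)) ** word_matrix w"
      by (simp add: word_matrix_def le)
    thus ?case by (simp add: map_conj_mult Cons adjg map_conj_gen_matrix cancel)
  qed
qed

lemma conj_poly_inverse:
  fixes p :: "'n entry_poly"
  assumes g: "det g = 1"
  shows "conj_poly (matrix_inv g) (conj_poly g p) = p"
proof -
  define h where "h = matrix_inv g"
  have h: "det h = 1" "matrix_inv h = g"
    unfolding h_def using matrix_inv_SL2(1)[OF g] matrix_inv_SL2(1)[of "adjugate2 g"] g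
    by (simp_all add: det_adjugate2 adjugate2_adjugate2)
  let ?C = "map_matrix pconst g" and ?D = "map_matrix pconst h"
  have CD: "?C ** ?D = mat 1" "?D ** ?C = mat 1"
    using matrix_inv_SL2[OF g] unfolding h_def
    by (simp_all add: map_matrix_pconst_one flip: map_matrix_pconst_mult)
  have gen: "map_matrix (conj_poly h) (map_matrix (conj_poly g) (gen_matrix l)) = gen_matrix l" for l :: 'n
  proof -
    have "map_matrix (conj_poly h) (map_matrix (conj_poly g) (gen_matrix l))
        = ?D ** (?C ** gen_matrix l ** ?D) ** ?C"
      unfolding map_conj_gen_matrix map_conj_mult map_conj_pconst h(2) by (simp only: h_def)
    also have "\<dots> = (?D ** ?C) ** gen_matrix l ** (?D ** ?C)" by (simp only: matrix_mul_assoc)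
    finally show ?thesis by (simp only: CD matrix_mul_lid matrix_mul_rid)
  qed
  have *: "conj_poly h (conj_poly g (pvar (l, i, j))) = pvar (l, i, j)" for l :: 'n and i j
    using arg_cong[OF gen[of l], of "\<lambda>M. M$i$j"] by (simp add: gen_matrix_def)
  define \<sigma> :: "'n \<times> 2 \<times> 2 \<Rightarrow> 'n entry_poly" where "\<sigma> = (\<lambda>(l, i, j). (map_matrix pconst (matrix_inv g) ** gen_matrix l ** map_matrix pconst g)$i$j)"
  have "conj_poly h (conj_poly g p) = psubst (\<lambda>v. conj_poly h (\<sigma> v)) p"
    by (simp add: conj_poly_def psubst_psubst \<sigma>_def)
  moreover have "conj_poly h (\<sigma> v) = pvar v" for v
  proof -
    have "\<sigma> v = conj_poly g (pvar v)" by (simp add: conj_poly_def \<sigma>_def)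
    thus ?thesis using * by (cases v) auto
  qed
  ultimately show ?thesis by (simp add: psubst_pvar_id h_def)
qed

section \<open>From invariant functions to the trace identities\<close>

text \<open>
  Transfer of the matrix identities. The map \<open>\<psi>\<close> respects sums and products only on a subring
  \<open>V\<close>, as a morphism defined on invariants does; it suffices that the identities involve the
  matrices only through traces of products.
\<close>

lemma (in group) sl2_character_of_matrices:
  fixes W :: "'a \<Rightarrow> 'r::comm_ring_1^2^2" and \<psi> :: "'r \<Rightarrow> complex fps" and V :: "'r set"
  assumes V_one: "1 \<in> V" and V_add: "\<And>p q. p \<in> V \<Longrightarrow> q \<in> V \<Longrightarrow> p + q \<in> V"
    and V_diff: "\<And>p q. p \<in> V \<Longrightarrow> q \<in> V \<Longrightarrow> p - q \<in> V"
    and V_mult: "\<And>p q. p \<in> V \<Longrightarrow> q \<in> V \<Longrightarrow> p * q \<in> V"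
    and one: "\<psi> 1 = 1" and add: "\<And>p q. p \<in> V \<Longrightarrow> q \<in> V \<Longrightarrow> \<psi> (p + q) = \<psi> p + \<psi> q"
    and mult: "\<And>p q. p \<in> V \<Longrightarrow> q \<in> V \<Longrightarrow> \<psi> (p * q) = \<psi> p * \<psi> q"
    and V_trace: "\<And>a. a \<in> carrier G \<Longrightarrow> trace (W a) \<in> V"
      "\<And>a b. a \<in> carrier G \<Longrightarrow> b \<in> carrier G \<Longrightarrow> trace (W a ** W b) \<in> V"
      "\<And>a b c. a \<in> carrier G \<Longrightarrow> b \<in> carrier G \<Longrightarrow> c \<in> carrier G \<Longrightarrow> trace (W a ** W b ** W c) \<in> V"
    and trace: "\<And>a b. a \<in> carrier G \<Longrightarrow> b \<in> carrier G \<Longrightarrow> \<psi> (trace (W (a \<otimes> b))) = \<psi> (trace (W a ** W b))"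
      "\<And>a b c. a \<in> carrier G \<Longrightarrow> b \<in> carrier G \<Longrightarrow> c \<in> carrier G \<Longrightarrow>
        \<psi> (trace (W (a \<otimes> b \<otimes> c))) = \<psi> (trace (W a ** W b ** W c))"
    and square: "\<And>a. a \<in> carrier G \<Longrightarrow> \<psi> (trace (W a ** W a)) = \<psi> (trace (W a) * trace (W a) - 2)"
  shows "sl2_character G (\<lambda>a. \<psi> (trace (W a)))"
proof -
  have diff: "\<psi> (p - q) = \<psi> p - \<psi> q" if "p \<in> V" "q \<in> V" for p q
    using add[of "p - q" q] V_diff[OF that] that by (simp add: eq_diff_eq)
  have two: "2 \<in> V" "\<psi> 2 = 2"
    using V_add[OF V_one V_one] add[OF V_one V_one] one by simp_all
  have four: "4 \<in> V" "\<psi> 4 = 4"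
    using V_add[OF two(1) two(1)] add[OF two(1) two(1)] two(2) by simp_all
  have zero: "0 \<in> V" "\<psi> 0 = 0" using V_diff[OF V_one V_one] diff[OF V_one V_one] by simp_all
  note hom = add diff mult two four zero V_add V_diff V_mult V_trace
  have formV: "matrix_form (W a) (W b) \<in> V" if "a \<in> carrier G" "b \<in> carrier G" for a b
    using that by (simp add: matrix_form_def hom)
  have volV: "matrix_volume (W a) (W b) (W c) \<in> V"
    if "a \<in> carrier G" "b \<in> carrier G" "c \<in> carrier G" for a b c
    using that by (simp add: matrix_volume_def hom)
  have form: "trace_form G (\<lambda>a. \<psi> (trace (W a))) a b = \<psi> (matrix_form (W a) (W b))"
    if "a \<in> carrier G" "b \<in> carrier G" for a b
    using that by (simp add: trace_form_def matrix_form_def trace(1) hom)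
  have vol: "trace_volume G (\<lambda>a. \<psi> (trace (W a))) a b c = \<psi> (matrix_volume (W a) (W b) (W c))"
    if "a \<in> carrier G" "b \<in> carrier G" "c \<in> carrier G" for a b c
    unfolding trace_volume_def trace(2)[OF that]
    using that by (simp add: matrix_volume_def trace(1) hom)
  show ?thesis
  proof
    show "\<psi> (trace (W (a \<otimes> b))) = \<psi> (trace (W (b \<otimes> a)))" if "a \<in> carrier G" "b \<in> carrier G" for a b
      unfolding trace(1)[OF that] trace(1)[OF that(2,1)] by (subst trace_mul_sym) (rule refl)
    show "\<psi> (trace (W (a \<otimes> a))) = \<psi> (trace (W a)) * \<psi> (trace (W a)) - 2" if "a \<in> carrier G" for a
      unfolding trace(1)[OF that that] square[OF that] using that by (simp add: hom)
  next
    fix a b c e f g assume S: "a \<in> carrier G" "b \<in> carrier G" "c \<in> carrier G"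
      "e \<in> carrier G" "f \<in> carrier G" "g \<in> carrier G"
    have "\<psi> (4 * matrix_volume (W a) (W b) (W c) * matrix_volume (W e) (W f) (W g)
        + minor3 matrix_form (W a) (W b) (W c) (W e) (W f) (W g)) = 0"
      unfolding matrix_volume_gram by (simp add: hom)
    thus "4 * trace_volume G (\<lambda>a. \<psi> (trace (W a))) a b c * trace_volume G (\<lambda>a. \<psi> (trace (W a))) e f g
        = - minor3 (trace_form G (\<lambda>a. \<psi> (trace (W a)))) a b c e f g"
      unfolding eq_neg_iff_add_eq_0 using S by (simp add: minor3_def minor2_def form vol formV volV hom)
  next
    fix a e f g h assume S: "a \<in> carrier G" "e \<in> carrier G" "f \<in> carrier G" "g \<in> carrier G" "h \<in> carrier G"
    have "\<psi> (matrix_form (W a) (W e) * matrix_volume (W f) (W g) (W h)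
        - matrix_form (W a) (W f) * matrix_volume (W e) (W g) (W h)
        + matrix_form (W a) (W g) * matrix_volume (W e) (W f) (W h)
        - matrix_form (W a) (W h) * matrix_volume (W e) (W f) (W g)) = 0"
      unfolding matrix_volume_cramer by (simp add: hom)
    thus "trace_form G (\<lambda>a. \<psi> (trace (W a))) a e * trace_volume G (\<lambda>a. \<psi> (trace (W a))) f g h
        - trace_form G (\<lambda>a. \<psi> (trace (W a))) a f * trace_volume G (\<lambda>a. \<psi> (trace (W a))) e g h
        + trace_form G (\<lambda>a. \<psi> (trace (W a))) a g * trace_volume G (\<lambda>a. \<psi> (trace (W a))) e f h
        - trace_form G (\<lambda>a. \<psi> (trace (W a))) a h * trace_volume G (\<lambda>a. \<psi> (trace (W a))) e f g = 0"
      using S by (simp add: form vol formV volV hom)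
  qed
qed

lemma entry_ring_simps [simp]:
  "carrier entry_ring = UNIV" "x \<otimes>\<^bsub>entry_ring\<^esub> y = x * y" "\<one>\<^bsub>entry_ring\<^esub> = 1"
  "\<zero>\<^bsub>entry_ring\<^esub> = 0" "x \<oplus>\<^bsub>entry_ring\<^esub> y = x + y"
  for x y :: "'n entry_poly"
  by (simp_all add: ring_of_type_algebra_def)

lemma fps_ring_simps [simp]:
  "x \<otimes>\<^bsub>ring_of_type_algebra\<^esub> y = x * y" "x \<oplus>\<^bsub>ring_of_type_algebra\<^esub> y = x + y"
  for x y :: "complex fps"
  by (simp_all add: ring_of_type_algebra_def)

lemma entry_ring: "cring (entry_ring :: 'n entry_poly ring)" "ring (entry_ring :: 'n entry_poly ring)"
  by (rule cring_from_type_algebra ring_from_type_algebra)+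

lemma idealI_entry_ring:
  fixes I :: "'n entry_poly set"
  assumes "0 \<in> I" "\<And>p q. p \<in> I \<Longrightarrow> q \<in> I \<Longrightarrow> p + q \<in> I" "\<And>p q. p \<in> I \<Longrightarrow> q * p \<in> I"
  shows "ideal I entry_ring"
proof (rule idealI[OF entry_ring(2)])
  have neg: "- p \<in> I" if "p \<in> I" for p using assms(3)[OF that, of "-1"] by simp
  have inv: "inv\<^bsub>add_monoid entry_ring\<^esub> p = - p" for p :: "'n entry_poly"
  proof -
    interpret R: ring "entry_ring :: 'n entry_poly ring" by (rule entry_ring)
    show ?thesis using R.minus_equality[of "- p" p] by (simp add: a_inv_def)
  qed
  show "subgroup I (add_monoid (entry_ring :: 'n entry_poly ring))"
  proof (rule subgroup.intro)
    show "inv\<^bsub>add_monoid entry_ring\<^esub> p \<in> I" if "p \<in> I" for p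
      unfolding inv by (rule neg[OF that])
  qed (simp_all add: assms)
  show "p \<otimes>\<^bsub>entry_ring\<^esub> q \<in> I" if "p \<in> I" for p q :: "'n entry_poly"
    using assms(3)[OF that, of q] by (simp add: mult.commute)
qed (simp add: assms(3))

locale generated_group = group G for G :: "('g, 'm) monoid_scheme" (structure) +
  fixes s :: "'n::finite \<Rightarrow> 'g"
  assumes gen_closed: "range s \<subseteq> carrier G"
    and gen: "generate G (range s) = carrier G"
begin

lemma s_closed [simp]: "s l \<in> carrier G"
  using gen_closed by auto

abbreviation "J \<equiv> rep_ideal G s"

lemma J_ideal: "ideal J entry_ring"
  unfolding rep_ideal_def by (rule ring.genideal_ideal[OF entry_ring(2)]) simp

lemma J_add: "p \<in> J \<Longrightarrow> q \<in> J \<Longrightarrow> p + q \<in> J"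
  using additive_subgroup.a_closed[OF ideal.axioms(1)[OF J_ideal]] by simp

lemma J_0: "0 \<in> J"
  using additive_subgroup.zero_closed[OF ideal.axioms(1)[OF J_ideal]] by simp

lemma J_mult: "p \<in> J \<Longrightarrow> q * p \<in> J" "p \<in> J \<Longrightarrow> p * q \<in> J"
  using ideal.I_l_closed[OF J_ideal] ideal.I_r_closed[OF J_ideal] by simp_all

lemma J_uminus: "p \<in> J \<Longrightarrow> - p \<in> J"
  using J_mult(1)[of p "-1"] by simp

lemma J_generators: "det (gen_matrix l) - 1 \<in> J"
    "word_value G s w = \<one> \<Longrightarrow> (word_matrix w)$i$j - (mat 1)$i$j \<in> J"
proof -
  have gens: "range (\<lambda>l. det (gen_matrix l) - 1) \<union>
     {(word_matrix w - mat 1)$i$j | w i j. word_value G s w = \<one>} \<subseteq> J"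
    unfolding rep_ideal_def by (rule ring.genideal_self[OF entry_ring(2)]) simp
  show "det (gen_matrix l) - 1 \<in> J" using gens by blast
  show "(word_matrix w)$i$j - (mat 1)$i$j \<in> J" if "word_value G s w = \<one>"
  proof -
    have "(word_matrix w - mat 1)$i$j \<in> J" using gens that by blast
    thus ?thesis by simp
  qed
qed

text \<open>
  Congruence modulo the relations of the representation variety. Working with congruent polynomial
  matrices, instead of matrices of cosets, keeps the matrix identities available as they stand.
\<close>

definition congruent_mats :: "'n entry_poly^2^2 \<Rightarrow> 'n entry_poly^2^2 \<Rightarrow> bool"
  where "congruent_mats A B \<longleftrightarrow> (\<forall>i j. A$i$j - B$i$j \<in> J)"

lemma congruent_refl: "congruent_mats A A"
  by (simp add: congruent_mats_def J_0)

lemma congruent_sym: "congruent_mats A B \<Longrightarrow> congruent_mats B A"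
  unfolding congruent_mats_def using J_uminus by (metis minus_diff_eq)

lemma congruent_trans: "congruent_mats A B \<Longrightarrow> congruent_mats B C \<Longrightarrow> congruent_mats A C"
  unfolding congruent_mats_def
proof (intro allI)
  fix i j assume "\<forall>i j. A$i$j - B$i$j \<in> J" "\<forall>i j. B$i$j - C$i$j \<in> J"
  hence "(A$i$j - B$i$j) + (B$i$j - C$i$j) \<in> J" by (intro J_add) auto
  thus "A$i$j - C$i$j \<in> J" by simp
qed

lemma congruent_mult:
  assumes "congruent_mats A B" "congruent_mats C D"
  shows "congruent_mats (A ** C) (B ** D)"
proof -
  have "(A ** C)$i$j - (B ** D)$i$j = ((A$i$1 - B$i$1) * C$1$j + B$i$1 * (C$1$j - D$1$j))
      + ((A$i$2 - B$i$2) * C$2$j + B$i$2 * (C$2$j - D$2$j))" for i j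
    by (simp add: matrix_matrix_mult_def sum_2 algebra_simps)
  thus ?thesis using assms unfolding congruent_mats_def by (simp add: J_add J_mult)
qed

lemma congruent_trace: "congruent_mats A B \<Longrightarrow> trace A - trace B \<in> J"
proof -
  assume "congruent_mats A B"
  hence "(A$1$1 - B$1$1) + (A$2$2 - B$2$2) \<in> J" by (intro J_add) (auto simp: congruent_mats_def)
  thus ?thesis by (simp add: trace_def sum_2 algebra_simps)
qed

lemma word_value_append:
  "word_value G s (w @ w') = word_value G s w \<otimes> word_value G s w'"
  and word_value_closed: "word_value G s w \<in> carrier G"
proof -
  have c: "word_value G s w \<in> carrier G" for w
    by (induction w) (auto simp: word_value_def)
  thus "word_value G s w \<in> carrier G" .
  show "word_value G s (w @ w') = word_value G s w \<otimes> word_value G s w'"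
  proof (induction w)
    case Nil
    then show ?case using c by (simp add: word_value_def)
  next
    case (Cons le w)
    then show ?case using c by (cases le) (simp add: word_value_def m_assoc)
  qed
qed

lemma word_matrix_append: "word_matrix (w @ w') = word_matrix w ** word_matrix w'"
  by (induction w) (auto simp: word_matrix_def matrix_mul_assoc)

lemma word_value_surj:
  assumes "a \<in> carrier G"
  shows "\<exists>w. word_value G s w = a"
proof -
  have "a \<in> generate G (range s)" using assms gen by simp
  thus ?thesis
  proof induction
    case one
    show ?case by (rule exI[of _ "[]"]) (simp add: word_value_def)
  next
    case (incl h)
    then obtain l where "h = s l" by auto
    thus ?case by (intro exI[of _ "[(l, True)]"]) (auto simp: word_value_def)
  next
    case (inv h)
    then obtain l where "h = s l" by auto
    thus ?case by (intro exI[of _ "[(l, False)]"]) (auto simp: word_value_def)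
  next
    case (eng h1 h2)
    thus ?case using word_value_append by metis
  qed
qed

text \<open>
  If \<open>v\<close> is a word for the inverse of the common value, then \<open>w v\<close> and \<open>v w'\<close> are relators, and
  \<open>w\<close> and \<open>w'\<close> are both congruent to \<open>w v w'\<close>.
\<close>

lemma congruent_words:
  assumes "word_value G s w = word_value G s w'"
  shows "congruent_mats (word_matrix w) (word_matrix w')"
proof -
  obtain v where v: "word_value G s v = inv (word_value G s w')"
    using word_value_surj word_value_closed by blast
  have "word_value G s (w @ v) = \<one>" "word_value G s (v @ w') = \<one>"
    using word_value_closed by (simp_all add: word_value_append v assms)
  hence "congruent_mats (word_matrix w ** word_matrix v) (mat 1)"
    "congruent_mats (word_matrix v ** word_matrix w') (mat 1)"
    using J_generators(2) by (simp_all add: congruent_mats_def flip: word_matrix_append)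
  hence 1: "congruent_mats (word_matrix w ** word_matrix v ** word_matrix w') (word_matrix w')"
    and 2: "congruent_mats (word_matrix w ** (word_matrix v ** word_matrix w')) (word_matrix w)"
    using congruent_mult[OF _ congruent_refl, of _ "mat 1" "word_matrix w'"]
      congruent_mult[OF congruent_refl, of _ "mat 1" "word_matrix w"] by simp_all
  show ?thesis using congruent_trans[OF congruent_sym[OF 2]] 1 by (simp add: matrix_mul_assoc)
qed

lemma det_word_matrix: "det (word_matrix w) - 1 \<in> J"
proof (induction w)
  case Nil
  show ?case by (simp add: word_matrix_def J_0)
next
  case (Cons le w)
  obtain l e where le: "le = (l, e)" by fastforce
  have "det (word_matrix (le # w)) = det (gen_matrix l) * det (word_matrix w)"
    by (simp add: word_matrix_def le det_mul det_adjugate2)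
  hence *: "det (word_matrix (le # w)) - 1
      = (det (gen_matrix l) - 1) * det (word_matrix w) + (det (word_matrix w) - 1)"
    by (simp add: algebra_simps)
  show ?case unfolding * by (intro J_add J_mult(2) J_generators(1) Cons)
qed

text \<open>
  Conjugation maps each generator of the ideal into the ideal: determinants do not change, and the
  entries of \<open>g\<^sup>-\<^sup>1 (W - 1) g\<close> are linear combinations of those of \<open>W - 1\<close>.
\<close>

lemma conj_poly_J:
  assumes g: "det g = 1" and p: "p \<in> J"
  shows "conj_poly g p \<in> J"
proof -
  let ?C = "map_matrix pconst g" and ?D = "map_matrix pconst (matrix_inv g)"
  have CD: "?D ** ?C = mat 1"
    using matrix_inv_SL2[OF g] by (simp add: map_matrix_pconst_one flip: map_matrix_pconst_mult)
  have DC: "?C ** ?D = mat 1"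
    using matrix_inv_SL2[OF g] by (simp add: map_matrix_pconst_one flip: map_matrix_pconst_mult)
  have "det (map_matrix (conj_poly g) (gen_matrix l)) = det (gen_matrix l)" for l :: 'n
  proof -
    have 1: "det ?C * det ?D = 1" unfolding det_mul[symmetric] DC by simp
    have 2: "det ?D * d * det ?C = d * (det ?C * det ?D)" for d by (simp only: mult_ac)
    show ?thesis unfolding map_conj_gen_matrix det_mul 2 1 by simp
  qed
  moreover have "conj_poly g (det A) = det (map_matrix (conj_poly g) A)" for A :: "'n entry_poly^2^2"
    by (simp add: det_2 conj_poly_simps)
  ultimately have 1: "conj_poly g (det (gen_matrix l) - 1) \<in> J" for l
    using J_generators(1) by (simp add: conj_poly_simps)
  have 2: "conj_poly g ((word_matrix w - mat 1)$i$j) \<in> J" if "word_value G s w = \<one>" for w i j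
  proof -
    have "congruent_mats (word_matrix w) (mat 1)"
      using J_generators(2)[OF that] by (simp add: congruent_mats_def)
    hence "congruent_mats (?D ** word_matrix w ** ?C) (?D ** mat 1 ** ?C)"
      by (intro congruent_mult congruent_refl)
    hence "congruent_mats (map_matrix (conj_poly g) (word_matrix w)) (mat 1)"
      by (simp add: map_conj_word_matrix[OF g] CD)
    hence "(map_matrix (conj_poly g) (word_matrix w))$i$j - (mat 1)$i$j \<in> J"
      by (simp add: congruent_mats_def)
    moreover have "conj_poly g ((mat 1 :: 'n entry_poly^2^2)$i$j) = (mat 1)$i$j"
      by (simp add: mat_def conj_poly_simps)
    ultimately show ?thesis by (simp add: conj_poly_simps)
  qed
  have "ideal {p. conj_poly g p \<in> J} entry_ring"
    by (rule idealI_entry_ring) (auto simp: conj_poly_simps J_0 J_add J_mult)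
  moreover have "range (\<lambda>l. det (gen_matrix l) - 1) \<union>
      {(word_matrix w - mat 1)$i$j | w i j. word_value G s w = \<one>} \<subseteq> {p. conj_poly g p \<in> J}"
    using 1 2 by blast
  ultimately have "J \<subseteq> {p. conj_poly g p \<in> J}"
    using ring.genideal_minimal[OF entry_ring(2)] unfolding rep_ideal_def by blast
  thus ?thesis using p by blast
qed

definition invariant_polys :: "'n entry_poly set"
  where "invariant_polys = {p. \<forall>g. det g = 1 \<longrightarrow> conj_poly g p = p}"

lemma trace_map: "conj_poly g (trace A) = trace (map_matrix (conj_poly g) A)"
  for A :: "'n entry_poly^2^2"
  by (simp add: trace_def sum_2 conj_poly_simps)

lemma word_trace_invariant: "trace (word_matrix w) \<in> invariant_polys"
  unfolding invariant_polys_def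
proof (intro CollectI allI impI)
  fix g :: "complex^2^2" assume g: "det g = 1"
  define C :: "'n entry_poly^2^2" where "C = map_matrix pconst g"
  define D :: "'n entry_poly^2^2" where "D = map_matrix pconst (matrix_inv g)"
  have CD: "C ** D = mat 1"
    unfolding C_def D_def map_matrix_pconst_mult[symmetric] matrix_inv_SL2(3)[OF g]
    by (rule map_matrix_pconst_one)
  have "conj_poly g (trace (word_matrix w)) = trace ((D ** word_matrix w) ** C)"
    unfolding trace_map map_conj_word_matrix[OF g] C_def D_def ..
  also have "\<dots> = trace (C ** (D ** word_matrix w))" by (rule trace_mul_sym)
  also have "\<dots> = trace (word_matrix w)" by (simp only: matrix_mul_assoc CD matrix_mul_lid)
  finally show "conj_poly g (trace (word_matrix w)) = trace (word_matrix w)" .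
qed

lemma rep_class_eq_image: "rep_class G s p = (\<lambda>j. j + p) ` J"
  unfolding rep_class_def a_r_coset_def' by auto

lemma rep_class_cong: "p - q \<in> J \<Longrightarrow> rep_class G s p = rep_class G s q"
proof -
  have sub: "rep_class G s p \<subseteq> rep_class G s q" if d: "p - q \<in> J" for p q
  proof
    fix r assume "r \<in> rep_class G s p"
    then obtain j where "j \<in> J" "r = j + p" by (auto simp: rep_class_eq_image)
    hence "r = (j + (p - q)) + q" by simp
    moreover have "j + (p - q) \<in> J" using \<open>j \<in> J\<close> d by (rule J_add)
    ultimately show "r \<in> rep_class G s q" unfolding rep_class_eq_image by blast
  qed
  assume "p - q \<in> J"
  moreover from this have "q - p \<in> J" using J_uminus[of "p - q"] by simp
  ultimately show ?thesis using sub by blast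
qed

lemma rep_class_hom: "rep_class G s \<in> ring_hom entry_ring (rep_ring G s)"
  using ideal.rcos_ring_hom[OF J_ideal] unfolding rep_ring_def rep_class_def[abs_def] .

text \<open>
  The invariants of the quotient are the cosets that are mapped onto themselves, so conjugation has to
  map the ideal onto itself, which follows by applying the inverse conjugation.
\<close>

lemma rep_class_invariant:
  assumes "p \<in> invariant_polys"
  shows "rep_class G s p \<in> carrier (inv_ring G s)"
proof -
  have "conj_poly g ` rep_class G s p = rep_class G s p" if g: "det g = 1" for g
  proof -
    have p: "conj_poly g p = p" using assms g by (simp add: invariant_polys_def)
    define h where "h = matrix_inv g"
    have h: "det h = 1" "matrix_inv h = g"
      unfolding h_def using matrix_inv_SL2(1)[OF g] matrix_inv_SL2(1)[of "adjugate2 g"] g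
      by (simp_all add: det_adjugate2 adjugate2_adjugate2)
    have "conj_poly g ` J = J"
    proof
      show "conj_poly g ` J \<subseteq> J" using conj_poly_J[OF g] by blast
      show "J \<subseteq> conj_poly g ` J"
      proof
        fix j assume "j \<in> J"
        moreover have "conj_poly g (conj_poly h j) = j" using conj_poly_inverse[OF h(1), of j] by (simp only: h(2))
        ultimately show "j \<in> conj_poly g ` J" using conj_poly_J[OF h(1)] by (metis image_eqI)
      qed
    qed
    have "conj_poly g ` rep_class G s p = (\<lambda>j. j + p) ` (conj_poly g ` J)"
      unfolding rep_class_eq_image image_image by (simp add: conj_poly_simps p)
    thus ?thesis unfolding \<open>conj_poly g ` J = J\<close> rep_class_eq_image .
  qed
  thus ?thesis
    using ring_hom_closed[OF rep_class_hom, of p] by (simp add: inv_ring_def SL2_def)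
qed

text \<open>
  The matrices \<open>W a\<close> of chosen words form a representation modulo the relations, and the traces of
  their products are invariant polynomials. Composing with the morphism gives a function that inherits
  all trace identities; its values are known because \<open>u\<close> and the trace differ by the constant 2.
\<close>

lemma invariant_hom_character:
  assumes \<phi>: "\<phi> \<in> inv_alg_hom G s"
    and f: "\<And>a. a \<in> carrier G \<Longrightarrow> \<phi> (u_fun G s a) = f a"
  shows "\<exists>x. sl2_character G x \<and> (\<forall>a\<in>carrier G. x a = 2 + f a)"
proof -
  define \<psi> where "\<psi> p = \<phi> (rep_class G s p)" for p
  define W where "W a = word_matrix (SOME w. word_value G s w = a)" for a
  have val: "word_value G s (SOME w. word_value G s w = a) = a" if "a \<in> carrier G" for a
    using word_value_surj[OF that] by (rule someI_ex)
  have hom: "\<phi> \<in> ring_hom (inv_ring G s) ring_of_type_algebra"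
    and const: "\<psi> (pconst c) = fps_const c" for c
    using \<phi> by (auto simp: inv_alg_hom_def \<psi>_def)
  have add: "\<psi> (p + q) = \<psi> p + \<psi> q" and mult: "\<psi> (p * q) = \<psi> p * \<psi> q"
    if "p \<in> invariant_polys" "q \<in> invariant_polys" for p q
  proof -
    note c = rep_class_invariant[OF that(1)] rep_class_invariant[OF that(2)]
    show "\<psi> (p + q) = \<psi> p + \<psi> q"
      using ring_hom_add[OF rep_class_hom, of p q] ring_hom_add[OF hom c]
      by (simp add: \<psi>_def inv_ring_def)
    show "\<psi> (p * q) = \<psi> p * \<psi> q"
      using ring_hom_mult[OF rep_class_hom, of p q] ring_hom_mult[OF hom c]
      by (simp add: \<psi>_def inv_ring_def)
  qed
  have cong: "\<psi> p = \<psi> q" if "p - q \<in> J" for p q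
    using rep_class_cong[OF that] by (simp add: \<psi>_def)
  have Wmult: "congruent_mats (W (a \<otimes> b)) (W a ** W b)" if "a \<in> carrier G" "b \<in> carrier G" for a b
    unfolding W_def word_matrix_append[symmetric]
    by (rule congruent_words) (simp add: word_value_append val that)
  have Wmult3: "congruent_mats (W (a \<otimes> b \<otimes> c)) (W a ** W b ** W c)"
    if "a \<in> carrier G" "b \<in> carrier G" "c \<in> carrier G" for a b c
    unfolding W_def word_matrix_append[symmetric]
    by (rule congruent_words) (simp add: word_value_append val that m_assoc)
  have "sl2_character G (\<lambda>a. \<psi> (trace (W a)))"
  proof (rule sl2_character_of_matrices[where V = invariant_polys])
    show "1 \<in> invariant_polys" by (simp add: invariant_polys_def conj_poly_simps)
    show "\<psi> 1 = 1" using const[of 1] by simp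
    show "trace (W a) \<in> invariant_polys" for a by (simp add: W_def word_trace_invariant)
    show "trace (W a ** W b) \<in> invariant_polys" "trace (W a ** W b ** W c) \<in> invariant_polys" for a b c
      by (simp_all add: W_def word_trace_invariant flip: word_matrix_append)
    show "\<psi> (trace (W (a \<otimes> b))) = \<psi> (trace (W a ** W b))" if "a \<in> carrier G" "b \<in> carrier G" for a b
      by (rule cong[OF congruent_trace[OF Wmult[OF that]]])
    show "\<psi> (trace (W (a \<otimes> b \<otimes> c))) = \<psi> (trace (W a ** W b ** W c))"
      if "a \<in> carrier G" "b \<in> carrier G" "c \<in> carrier G" for a b c
      by (rule cong[OF congruent_trace[OF Wmult3[OF that]]])
    show "\<psi> (trace (W a ** W a)) = \<psi> (trace (W a) * trace (W a) - 2)" for a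
    proof (rule cong)
      have "trace (W a ** W a) - (trace (W a) * trace (W a) - 2) = (-2) * (det (W a) - 1)"
        unfolding trace_square by (simp add: algebra_simps)
      thus "trace (W a ** W a) - (trace (W a) * trace (W a) - 2) \<in> J"
        unfolding W_def by (simp only:) (rule J_mult(1)[OF det_word_matrix])
    qed
  qed (auto simp: invariant_polys_def conj_poly_simps add mult)
  moreover have "\<psi> (trace (W a)) = 2 + f a" if a: "a \<in> carrier G" for a
  proof -
    interpret Q: ring "rep_ring G s"
      unfolding rep_ring_def by (rule ideal.quotient_is_ring[OF J_ideal])
    define c :: "'n entry_poly" where "c = pconst 2"
    have c: "c \<in> invariant_polys" by (simp add: c_def invariant_polys_def conj_poly_simps)
    have closed: "rep_class G s p \<in> carrier (rep_ring G s)" for p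
      using ring_hom_closed[OF rep_class_hom, of p] by simp
    have "rep_class G s (trace (W a)) = rep_class G s (trace (W a) - c) \<oplus>\<^bsub>rep_ring G s\<^esub> rep_class G s c"
      using ring_hom_add[OF rep_class_hom, of "trace (W a) - c" c] by simp
    hence "rep_class G s (trace (W a) - c) = rep_class G s (trace (W a)) \<ominus>\<^bsub>rep_ring G s\<^esub> rep_class G s c"
      using closed by (simp add: a_minus_def Q.add.m_assoc Q.r_neg)
    hence "u_fun G s a = rep_class G s (trace (W a) - c)"
      by (simp add: u_fun_def trace_fun_def W_def c_def)
    hence "\<psi> (trace (W a) - c) = f a" using f[OF a] by (simp add: \<psi>_def)
    moreover have "trace (W a) - c \<in> invariant_polys"
      using word_trace_invariant c unfolding W_def by (auto simp: invariant_polys_def conj_poly_simps)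
    hence "\<psi> (trace (W a)) = \<psi> (trace (W a) - c) + \<psi> c"
      using add[OF _ c, of "trace (W a) - c"] by simp
    moreover have "\<psi> c = 2" unfolding c_def const by (simp add: numeral_fps_const)
    ultimately show ?thesis by simp
  qed
  ultimately show ?thesis by blast
qed

end

section \<open>Representations with trivial character\<close>

lemma eval0_mult: "eval0 (A ** B) = eval0 A ** eval0 B"
  by (simp add: eval0_def vec_eq_iff matrix_matrix_mult_def sum_2)

lemma eval0_det: "det (eval0 A) = fps_nth (det A) 0"
  by (simp add: eval0_def det_2)

lemma eval0_trace: "trace (eval0 A) = fps_nth (trace A) 0"
  by (simp add: eval0_def trace_def sum_2)

lemma matrix_inv_one: "matrix_inv (mat 1 :: complex^2^2) = mat 1"
  using matrix_inv_SL2(2)[of "mat 1"] by simp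

text \<open>
  Such a matrix has the single eigenvalue 1, and conjugating an eigenvector to the first basis vector
  makes it triangular.
\<close>

lemma SL2_trace2_conj:
  fixes A :: "complex^2^2"
  assumes "det A = 1" "trace A = 2" "A \<noteq> mat 1"
  obtains g a where "det g = 1" "g ** A ** matrix_inv g = vector [vector [1, a], vector [0, 1]]" "a \<noteq> 0"
proof -
  have d: "A$2$2 = 2 - A$1$1" using assms(2) by (simp add: trace_def sum_2 algebra_simps)
  have bc: "A$1$2 * A$2$1 = - ((A$1$1 - 1) * (A$1$1 - 1))"
    using assms(1) by (simp add: det_2 d algebra_simps)
  show ?thesis
  proof (cases "A$2$1 = 0")
    case True
    hence a: "A$1$1 = 1" using bc by simp
    have "A$1$2 \<noteq> 0" using assms(3) True a d by (auto simp: vec_eq_iff forall_2 mat_def)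
    moreover have "A = vector [vector [1, A$1$2], vector [0, 1]]"
      using True a d by (simp add: vec_eq_iff forall_2)
    ultimately show ?thesis using that[of "mat 1" "A$1$2"] by (simp add: matrix_inv_one)
  next
    case False
    define c where "c = A$2$1"
    define y where "y = A$1$1 - 1"
    have c: "c \<noteq> 0" using False by (simp add: c_def)
    have b: "A$1$2 = - (y * y) / c" using bc c by (simp add: c_def y_def field_simps)
    \<comment> \<open>Conjugation by \<open>g\<close> takes the eigenvector \<open>(y / c, 1)\<close> to a multiple of the first basis vector.\<close>
    define g :: "complex^2^2" where "g = vector [vector [0, 1], vector [-1, y / c]]"
    have g: "det g = 1" by (simp add: g_def det_2)
    have A: "A$1$1 = 1 + y" "A$2$2 = 1 - y" "A$2$1 = c" by (simp_all add: y_def d c_def)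
    have "g ** A ** matrix_inv g = vector [vector [1, - c], vector [0, 1]]"
      unfolding matrix_inv_SL2(1)[OF g] using c
      by (simp add: g_def adjugate2_def vec_eq_iff forall_2 matrix_matrix_mult_def sum_2 A b field_simps)
    thus ?thesis using that[OF g] c by simp
  qed
qed

text \<open>
  If some matrix is not the identity, it may be assumed to be upper unipotent with a nonzero entry \<open>k\<close>.
  The trace of its product with another matrix \<open>B\<close> of trace 2 is \<open>2 + k B21\<close>, hence \<open>B21 = 0\<close>, and
  then the diagonal entries of \<open>B\<close> have sum 2 and product 1.
\<close>

lemma (in group) trivial_character_unipotent:
  fixes \<sigma> :: "'a \<Rightarrow> complex^2^2"
  assumes hom: "\<sigma> \<in> hom G SL2" and tr: "\<forall>a \<in> carrier G. trace (\<sigma> a) = 2"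
  shows "\<exists>g \<in> carrier SL2. (\<lambda>a. g ** \<sigma> a ** matrix_inv g) \<in> hom G unipotent_upper"
proof -
  have \<sigma>mult: "\<sigma> (a \<otimes> b) = \<sigma> a ** \<sigma> b" if "a \<in> carrier G" "b \<in> carrier G" for a b
    using hom that by (auto simp: hom_def SL2_def)
  have \<sigma>det: "det (\<sigma> a) = 1" if "a \<in> carrier G" for a
    using hom that by (auto simp: hom_def SL2_def)
  have "\<exists>g. det g = 1 \<and> (\<forall>b \<in> carrier G. (g ** \<sigma> b ** matrix_inv g)$1$1 = 1
      \<and> (g ** \<sigma> b ** matrix_inv g)$2$2 = 1 \<and> (g ** \<sigma> b ** matrix_inv g)$2$1 = 0)"
  proof (cases "\<forall>a \<in> carrier G. \<sigma> a = mat 1")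
    case True
    have one: "(mat 1 :: complex^2^2)$1$1 = 1" "(mat 1 :: complex^2^2)$2$2 = 1" "(mat 1 :: complex^2^2)$2$1 = 0"
      by (simp_all add: mat_def)
    show ?thesis using True by (intro exI[of _ "mat 1"]) (simp add: matrix_inv_one one)
  next
    case False
    then obtain a where a: "a \<in> carrier G" "\<sigma> a \<noteq> mat 1" by blast
    then obtain g k where g: "det g = 1"
      and k: "g ** \<sigma> a ** matrix_inv g = vector [vector [1, k], vector [0, 1]]" "k \<noteq> 0"
      using SL2_trace2_conj \<sigma>det tr by metis
    have conj_trace: "trace (g ** M ** matrix_inv g) = trace M" for M
    proof -
      have "trace (g ** M ** matrix_inv g) = trace (matrix_inv g ** (g ** M))" by (rule trace_mul_sym)
      thus ?thesis by (simp only: matrix_mul_assoc matrix_inv_SL2(2)[OF g] matrix_mul_lid)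
    qed
    have conj_mult: "g ** (M ** N) ** matrix_inv g = (g ** M ** matrix_inv g) ** (g ** N ** matrix_inv g)" for M N
    proof -
      have "(g ** M ** matrix_inv g) ** (g ** N ** matrix_inv g) = g ** M ** (matrix_inv g ** g) ** N ** matrix_inv g"
        by (simp only: matrix_mul_assoc)
      thus ?thesis by (simp only: matrix_inv_SL2(2)[OF g] matrix_mul_rid matrix_mul_assoc)
    qed
    have "B$1$1 = 1 \<and> B$2$2 = 1 \<and> B$2$1 = 0"
      if b: "b \<in> carrier G" and B: "B = g ** \<sigma> b ** matrix_inv g" for b B
    proof -
      have t: "B$1$1 + B$2$2 = 2"
        using conj_trace[of "\<sigma> b"] tr b by (simp add: B[symmetric] trace_def sum_2)
      hence B2: "B$2$2 = 2 - B$1$1" by (simp add: algebra_simps)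
      have "trace (vector [vector [1, k], vector [0, 1]] ** B) = 2"
      proof -
        have "trace (g ** (\<sigma> a ** \<sigma> b) ** matrix_inv g) = 2"
          unfolding conj_trace \<sigma>mult[OF a(1) b, symmetric] using tr a b by simp
        thus ?thesis by (simp only: conj_mult k(1) B)
      qed
      hence "B$1$1 + k * B$2$1 + B$2$2 = 2"
        by (simp add: trace_def sum_2 matrix_matrix_mult_def)
      hence "k * B$2$1 = 0" by (simp add: B2)
      hence c: "B$2$1 = 0" using k(2) by simp
      have "det B = 1" unfolding B using g \<sigma>det[OF b]
        by (simp add: det_mul matrix_inv_SL2(1) det_adjugate2)
      hence "B$1$1 * B$2$2 = 1" by (simp add: det_2 c)
      hence "(B$1$1 - 1) * (B$1$1 - 1) = 0" by (simp add: B2 algebra_simps)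
      hence "B$1$1 = 1" by simp
      with B2 c show ?thesis by simp
    qed
    with g show ?thesis by blast
  qed
  then obtain g where g: "det g = 1" and upper: "\<forall>b \<in> carrier G. (g ** \<sigma> b ** matrix_inv g)$1$1 = 1
      \<and> (g ** \<sigma> b ** matrix_inv g)$2$2 = 1 \<and> (g ** \<sigma> b ** matrix_inv g)$2$1 = 0" by blast
  have "g ** \<sigma> (a \<otimes> b) ** matrix_inv g = (g ** \<sigma> a ** matrix_inv g) ** (g ** \<sigma> b ** matrix_inv g)"
    if "a \<in> carrier G" "b \<in> carrier G" for a b
  proof -
    have "(g ** \<sigma> a ** matrix_inv g) ** (g ** \<sigma> b ** matrix_inv g)
        = g ** \<sigma> a ** (matrix_inv g ** g) ** \<sigma> b ** matrix_inv g"
      by (simp only: matrix_mul_assoc)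
    thus ?thesis by (simp only: matrix_inv_SL2(2)[OF g] matrix_mul_rid \<sigma>mult[OF that] matrix_mul_assoc)
  qed
  with upper have "(\<lambda>a. g ** \<sigma> a ** matrix_inv g) \<in> hom G unipotent_upper"
    by (auto simp: hom_def unipotent_upper_def SL2_def)
  thus ?thesis using g by (auto simp: SL2_def)
qed

section \<open>The deformation of the trivial character\<close>

theorem theorem1p5:
  fixes \<Gamma> :: "('g, 'm) monoid_scheme"
    and s :: "'n::finite \<Rightarrow> 'g"
    and f_coeff :: "nat \<Rightarrow> 'g \<Rightarrow> complex"
    and f :: "'g \<Rightarrow> complex fps"
  assumes "group \<Gamma>"
    and "range s \<subseteq> carrier \<Gamma>"
    and "generate \<Gamma> (range s) = carrier \<Gamma>"
    and "\<And>\<gamma>. \<gamma> \<in> carrier \<Gamma> \<Longrightarrow> f \<gamma> = Abs_fps (\<lambda>k. if k = 0 then 0 else f_coeff k \<gamma>)"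
    and "\<exists>\<phi> \<in> inv_alg_hom \<Gamma> s. \<forall>\<gamma> \<in> carrier \<Gamma>. \<phi> (u_fun \<Gamma> s \<gamma>) = f \<gamma>"
  shows "\<exists>\<rho> \<in> hom \<Gamma> (SL2 :: (complex fps^2^2) monoid).
    (\<forall>\<gamma> \<in> carrier \<Gamma>. 2 + f \<gamma> = trace (\<rho> \<gamma>)) \<and>
    (\<forall>\<gamma> \<in> carrier \<Gamma>. trace (eval0 (\<rho> \<gamma>)) = 2) \<and>
    (\<exists>g \<in> carrier SL2.
       (\<lambda>\<gamma>. g ** eval0 (\<rho> \<gamma>) ** matrix_inv g) \<in> hom \<Gamma> unipotent_upper)"
proof -
  have gen: "generated_group \<Gamma> s"
    using assms(1-3) by (simp add: generated_group_def generated_group_axioms_def)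
  from assms(5) obtain \<phi> where \<phi>: "\<phi> \<in> inv_alg_hom \<Gamma> s"
    and \<phi>u: "\<And>\<gamma>. \<gamma> \<in> carrier \<Gamma> \<Longrightarrow> \<phi> (u_fun \<Gamma> s \<gamma>) = f \<gamma>" by blast
  obtain x where x: "sl2_character \<Gamma> x" "\<forall>\<gamma> \<in> carrier \<Gamma>. x \<gamma> = 2 + f \<gamma>"
    using generated_group.invariant_hom_character[OF gen \<phi> \<phi>u] by blast
  obtain \<rho> where \<rho>: "\<rho> \<in> hom \<Gamma> SL2" and tr: "\<forall>\<gamma> \<in> carrier \<Gamma>. trace (\<rho> \<gamma>) = x \<gamma>"
    using sl2_character.exists_representation[OF x(1)] by blast
  have tr0: "\<forall>\<gamma> \<in> carrier \<Gamma>. trace (eval0 (\<rho> \<gamma>)) = 2"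
    using tr x(2) assms(4) by (simp add: eval0_trace)
  have "(\<lambda>\<gamma>. eval0 (\<rho> \<gamma>)) \<in> hom \<Gamma> SL2"
    using \<rho> by (auto simp: hom_def SL2_def eval0_mult eval0_det Pi_iff)
  from group.trivial_character_unipotent[OF assms(1) this tr0]
  show ?thesis using \<rho> tr tr0 x(2) by (intro bexI[of _ \<rho>]) auto
qed

end
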